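(* Let $\lambda$ be an ordinal and $X:\lambda\to\mathbf{MdTop}$ a colimit-preserving functor with $X_0=(X^0,X^0,\varnothing)$ a set and, for every $\nu<\lambda$, $X_\nu\to X_{\nu+1}$ a pushout of ${\rm Glob}^{\mathcal{G}}(\mathbf{S}^{n_\nu-1})\subset{\rm Glob}^{\mathcal{G}}(\mathbf{D}^{n_\nu})$ along some map ${\rm Glob}^{\mathcal{G}}(\mathbf{S}^{n_\nu-1})\to X_\nu$, $n_\nu\ge0$. Let $X_\lambda=\varinjlim_{\nu<\lambda}X_\nu$. Then the composite functor $\nu\mapsto\mathbb{P}^{\mathcal{G}}X_\nu$ from $\lambda$ to $\mathbf{Top}$ is colimit-preserving; in particular the continuous bijection $\varinjlim_{\nu<\lambda}\mathbb{P}^{\mathcal{G}}X_\nu\to\mathbb{P}^{\mathcal{G}}X_\lambda$ is a homeomorphism. Moreover, the topology of $\mathbb{P}^{\mathcal{G}}X_\lambda$ is the final topology.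
   Context: Work in $\mathbf{Top}$, the category of $\Delta$-generated spaces (or $\Delta$-Hausdorff $\Delta$-generated spaces), cartesian closed with internal hom ${\rm TOP}$; subsets carry the $\Delta$-kelleyfication of the relative topology. $\mathcal{G}(1,1)$: nondecreasing homeomorphisms of $[0,1]$; $*_N$: normalized composition of paths on $[0,1]$. A multipointed $d$-space $X=(|X|,X^0,\mathbb{P}^{\mathcal{G}}X)$: a space, a subset of states, a set of continuous execution paths $[0,1]\to|X|$ with endpoints in $X^0$, stable under precomposition by $\mathcal{G}(1,1)$ and $*_N$; maps preserve states and paths; category $\mathbf{MdTop}$. $\mathbb{P}^{\mathcal{G}}_{\alpha,\beta}X$ is a subspace of ${\rm TOP}([0,1],|X|)$ and $\mathbb{P}^{\mathcal{G}}X=\bigsqcup_{(\alpha,\beta)\in X^0\times X^0}\mathbb{P}^{\mathcal{G}}_{\alpha,\beta}X$. Colimits in $\mathbf{MdTop}$: underlying spaces and states by colimits, execution paths generated by images under $*_N$ and reparametrization. ${\rm Glob}^{\mathcal{G}}(Z)$: quotient of $\{0,1\}\sqcup Z\times[0,1]$ with $(z,0)\sim0$, $(z,1)\sim1$, states $\{0,1\}$, paths $t\mapsto(z,\phi(t))$, $\phi\in\mathcal{G}(1,1)$; sets $E$ are $(E,E,\varnothing)$. *)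

theory Defs
  imports "HOL-Analysis.Analysis" "HOL-Homology.Simplices"
begin

definition simplex_top :: "nat \<Rightarrow> (nat \<Rightarrow> real) topology" where
  "simplex_top n = subtopology (powertop_real UNIV) (standard_simplex n)"

definition unit_top :: "real topology" where
  "unit_top = top_of_set {0..1}"

definition kdelta :: "'a topology \<Rightarrow> 'a topology" where
  "kdelta X = topology (\<lambda>U. U \<subseteq> topspace X \<and>
     (\<forall>n \<sigma>. continuous_map (simplex_top n) X \<sigma> \<longrightarrow>
        openin (simplex_top n) {x \<in> standard_simplex n. \<sigma> x \<in> U}))"

definition delta_generated :: "'a topology \<Rightarrow> bool" where
  "delta_generated X \<longleftrightarrow> kdelta X = X"

definition dsub :: "'a topology \<Rightarrow> 'a set \<Rightarrow> 'a topology" where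
  "dsub X S = kdelta (subtopology X S)"

definition cpaths :: "'a topology \<Rightarrow> (real \<Rightarrow> 'a) set" where
  "cpaths X = {\<gamma>. \<gamma> \<in> extensional {0..1} \<and> continuous_map unit_top X \<gamma>}"

text \<open>TOP([0,1],X) in Delta-generated spaces: the Delta-generated topology on the set of
  continuous paths whose plots are the maps from simplices with continuous adjoint.\<close>
definition path_top :: "'a topology \<Rightarrow> (real \<Rightarrow> 'a) topology" where
  "path_top X = topology (\<lambda>U. U \<subseteq> cpaths X \<and>
     (\<forall>n (g :: (nat \<Rightarrow> real) \<Rightarrow> real \<Rightarrow> 'a).
        (\<forall>x\<in>standard_simplex n. g x \<in> cpaths X) \<and>
        continuous_map (prod_topology (simplex_top n) unit_top) X (\<lambda>p. g (fst p) (snd p))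
        \<longrightarrow> openin (simplex_top n) {x \<in> standard_simplex n. g x \<in> U}))"

definition reparam :: "(real \<Rightarrow> real) set" where
  "reparam = {\<phi>. homeomorphic_map unit_top unit_top \<phi> \<and> mono_on {0..1} \<phi>}"

definition pmap :: "('a \<Rightarrow> 'b) \<Rightarrow> (real \<Rightarrow> 'a) \<Rightarrow> (real \<Rightarrow> 'b)" where
  "pmap f \<gamma> = restrict (f \<circ> \<gamma>) {0..1}"

definition ncomp :: "(real \<Rightarrow> 'a) \<Rightarrow> (real \<Rightarrow> 'a) \<Rightarrow> (real \<Rightarrow> 'a)" where
  "ncomp \<gamma>1 \<gamma>2 = restrict (\<lambda>t. if t \<le> 1/2 then \<gamma>1 (2*t) else \<gamma>2 (2*t - 1)) {0..1}"

definition path_closed :: "(real \<Rightarrow> 'a) set \<Rightarrow> bool" where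
  "path_closed P \<longleftrightarrow>
     (\<forall>\<gamma>\<in>P. \<forall>\<phi>\<in>reparam. restrict (\<gamma> \<circ> \<phi>) {0..1} \<in> P) \<and>
     (\<forall>\<gamma>1\<in>P. \<forall>\<gamma>2\<in>P. \<gamma>1 1 = \<gamma>2 0 \<longrightarrow> ncomp \<gamma>1 \<gamma>2 \<in> P)"

definition gen_paths :: "(real \<Rightarrow> 'a) set \<Rightarrow> (real \<Rightarrow> 'a) set" where
  "gen_paths S = \<Inter>{P. S \<subseteq> P \<and> path_closed P}"

record 'a mdspace =
  md_top :: "'a topology"
  md_states :: "'a set"
  md_paths :: "(real \<Rightarrow> 'a) set"

definition is_mdspace :: "'a mdspace \<Rightarrow> bool" where
  "is_mdspace X \<longleftrightarrow> delta_generated (md_top X) \<and>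
     md_states X \<subseteq> topspace (md_top X) \<and>
     md_paths X \<subseteq> cpaths (md_top X) \<and>
     (\<forall>\<gamma>\<in>md_paths X. \<gamma> 0 \<in> md_states X \<and> \<gamma> 1 \<in> md_states X) \<and>
     path_closed (md_paths X)"

definition md_map :: "'a mdspace \<Rightarrow> 'b mdspace \<Rightarrow> ('a \<Rightarrow> 'b) \<Rightarrow> bool" where
  "md_map X Y f \<longleftrightarrow> continuous_map (md_top X) (md_top Y) f \<and>
     f ` md_states X \<subseteq> md_states Y \<and> pmap f ` md_paths X \<subseteq> md_paths Y"

definition md_set :: "'a set \<Rightarrow> 'a mdspace" where
  "md_set E = \<lparr>md_top = discrete_topology E, md_states = E, md_paths = {}\<rparr>"

text \<open>The space of execution paths P^G X: disjoint sum of the subspaces P_{a,b} X of TOP([0,1],|X|).\<close>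
definition exec_paths_ab :: "'a mdspace \<Rightarrow> 'a \<Rightarrow> 'a \<Rightarrow> (real \<Rightarrow> 'a) set" where
  "exec_paths_ab X a b = {\<gamma> \<in> md_paths X. \<gamma> 0 = a \<and> \<gamma> 1 = b}"

definition exec_top :: "'a mdspace \<Rightarrow> (real \<Rightarrow> 'a) topology" where
  "exec_top X = topology (\<lambda>U. U \<subseteq> md_paths X \<and>
     (\<forall>a\<in>md_states X. \<forall>b\<in>md_states X.
        openin (dsub (path_top (md_top X)) (exec_paths_ab X a b)) (U \<inter> exec_paths_ab X a b)))"

text \<open>R^n is represented inside nat => real (coordinates >= n vanish).\<close>
definition disk :: "nat \<Rightarrow> (nat \<Rightarrow> real) set" where
  "disk n = {x. (\<forall>i\<ge>n. x i = 0) \<and> (\<Sum>i<n. (x i)\<^sup>2) \<le> 1}"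

text \<open>sphere n is S^{n-1}; in particular sphere 0 is empty.\<close>
definition sphere_m1 :: "nat \<Rightarrow> (nat \<Rightarrow> real) set" where
  "sphere_m1 n = {x. (\<forall>i\<ge>n. x i = 0) \<and> (\<Sum>i<n. (x i)\<^sup>2) = 1}"

type_synonym glob_pt = "bool + ((nat \<Rightarrow> real) \<times> real)"

text \<open>The point of Glob(Z) represented by (z,t): Inl False = 0, Inl True = 1.\<close>
definition glob_pt :: "(nat \<Rightarrow> real) \<Rightarrow> real \<Rightarrow> glob_pt" where
  "glob_pt z t = (if t = 0 then Inl False else if t = 1 then Inl True else Inr (z, t))"

definition glob_carrier :: "(nat \<Rightarrow> real) set \<Rightarrow> glob_pt set" where
  "glob_carrier Z = {Inl False, Inl True} \<union> (\<lambda>p. glob_pt (fst p) (snd p)) ` (Z \<times> {0..1})"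

text \<open>Quotient topology of {0,1} + Z x [0,1] (Delta-kelleyfied).\<close>
definition glob_top :: "(nat \<Rightarrow> real) set \<Rightarrow> glob_pt topology" where
  "glob_top Z = kdelta (topology (\<lambda>U. U \<subseteq> glob_carrier Z \<and>
     openin (prod_topology (top_of_set Z) unit_top)
        {p \<in> Z \<times> {0..1}. glob_pt (fst p) (snd p) \<in> U}))"

definition Glob :: "(nat \<Rightarrow> real) set \<Rightarrow> glob_pt mdspace" where
  "Glob Z = \<lparr>md_top = glob_top Z, md_states = {Inl False, Inl True},
     md_paths = {restrict (\<lambda>t. glob_pt z (\<phi> t)) {0..1} | z \<phi>. z \<in> Z \<and> \<phi> \<in> reparam}\<rparr>"

definition md_colimit ::
  "'i::linorder set \<Rightarrow> ('i \<Rightarrow> 'a mdspace) \<Rightarrow> ('i \<Rightarrow> 'i \<Rightarrow> 'a \<Rightarrow> 'a) \<Rightarrow> 'b mdspace \<Rightarrow> ('i \<Rightarrow> 'a \<Rightarrow> 'b) \<Rightarrow> bool" where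
  "md_colimit I X f Y h \<longleftrightarrow>
     topspace (md_top Y) = (\<Union>i\<in>I. h i ` topspace (md_top (X i))) \<and>
     (\<forall>i\<in>I. \<forall>j\<in>I. \<forall>x\<in>topspace (md_top (X i)). \<forall>y\<in>topspace (md_top (X j)).
        h i x = h j y \<longrightarrow> (\<exists>k\<in>I. i \<le> k \<and> j \<le> k \<and> f i k x = f j k y)) \<and>
     (\<forall>U. openin (md_top Y) U \<longleftrightarrow> U \<subseteq> topspace (md_top Y) \<and>
        (\<forall>i\<in>I. openin (md_top (X i)) {x \<in> topspace (md_top (X i)). h i x \<in> U})) \<and>
     md_states Y = (\<Union>i\<in>I. h i ` md_states (X i)) \<and>
     md_paths Y = gen_paths (\<Union>i\<in>I. pmap (h i) ` md_paths (X i))"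

definition glob_pushout ::
  "nat \<Rightarrow> (glob_pt \<Rightarrow> 'a) \<Rightarrow> 'a mdspace \<Rightarrow> 'a mdspace \<Rightarrow> ('a \<Rightarrow> 'a) \<Rightarrow> (glob_pt \<Rightarrow> 'a) \<Rightarrow> bool" where
  "glob_pushout n g X Y f gh \<longleftrightarrow>
     (let A = glob_carrier (sphere_m1 n); B = glob_carrier (disk n) in
      md_map (Glob (sphere_m1 n)) X g \<and> md_map (Glob (disk n)) Y gh \<and>
      (\<forall>a\<in>A. gh a = f (g a)) \<and>
      inj_on f (topspace (md_top X)) \<and> inj_on gh (B - A) \<and>
      f ` topspace (md_top X) \<inter> gh ` (B - A) = {} \<and>
      topspace (md_top Y) = f ` topspace (md_top X) \<union> gh ` B \<and>
      (\<forall>U. openin (md_top Y) U \<longleftrightarrow> U \<subseteq> topspace (md_top Y) \<and>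
         openin (md_top X) {x \<in> topspace (md_top X). f x \<in> U} \<and>
         openin (glob_top (disk n)) {x \<in> B. gh x \<in> U}) \<and>
      md_states Y = f ` md_states X \<union> gh ` md_states (Glob (disk n)) \<and>
      md_paths Y = gen_paths (pmap f ` md_paths X \<union> pmap gh ` md_paths (Glob (disk n))))"

definition top_colimit ::
  "'i::linorder set \<Rightarrow> ('i \<Rightarrow> 'a topology) \<Rightarrow> ('i \<Rightarrow> 'i \<Rightarrow> 'a \<Rightarrow> 'a) \<Rightarrow> 'b topology \<Rightarrow> ('i \<Rightarrow> 'a \<Rightarrow> 'b) \<Rightarrow> bool" where
  "top_colimit I T f S h \<longleftrightarrow>
     topspace S = (\<Union>i\<in>I. h i ` topspace (T i)) \<and>
     (\<forall>i\<in>I. \<forall>j\<in>I. \<forall>x\<in>topspace (T i). \<forall>y\<in>topspace (T j).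
        h i x = h j y \<longrightarrow> (\<exists>k\<in>I. i \<le> k \<and> j \<le> k \<and> f i k x = f j k y)) \<and>
     (\<forall>U. openin S U \<longleftrightarrow> U \<subseteq> topspace S \<and>
        (\<forall>i\<in>I. openin (T i) {x \<in> topspace (T i). h i x \<in> U}))"

definition is_succ :: "'i::wellorder \<Rightarrow> 'i \<Rightarrow> bool" where
  "is_succ \<nu> \<nu>' \<longleftrightarrow> \<nu> < \<nu>' \<and> (\<forall>\<rho>. \<nu> < \<rho> \<longrightarrow> \<nu>' \<le> \<rho>)"

definition is_limit :: "'i::wellorder \<Rightarrow> bool" where
  "is_limit \<nu> \<longleftrightarrow> (\<exists>\<mu>. \<mu> < \<nu>) \<and> (\<forall>\<mu><\<nu>. \<exists>\<rho>. \<mu> < \<rho> \<and> \<rho> < \<nu>)"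

definition is_least :: "'i::wellorder \<Rightarrow> bool" where
  "is_least \<nu> \<longleftrightarrow> (\<forall>\<mu>. \<not> \<mu> < \<nu>)"

end

theory Submission
  imports Defs
begin

text \<open>
  The globe of a sphere is the union of two points and finitely many images of simplices in a
  Hausdorff space, so attaching a globe is a closed embedding in spite of the kelleyfication. It
  also reflects execution paths, because a globe path through the interior of the disk leaves the
  earlier space. Both properties pass to transfinite compositions and to the colimit cocone. All
  stages are \<open>T\<^sub>1\<close>, hence a compact subset of the colimit lies in one stage. A continuous map
  from a simplex to the space of execution paths of the colimit has a continuous adjoint on a
  compact product, hence it factors through the execution paths of one stage, which yields the
  final topology.
\<close>

section \<open>Final topologies and uncurrying\<close>

definition final_topology :: "'b set \<Rightarrow> ('a topology \<times> ('a \<Rightarrow> 'b)) set \<Rightarrow> 'b topology" where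
  "final_topology S F =
     topology (\<lambda>U. U \<subseteq> S \<and> (\<forall>(T, \<sigma>)\<in>F. openin T {x \<in> topspace T. \<sigma> x \<in> U}))"

lemma openin_final_topology:
  "openin (final_topology S F) U \<longleftrightarrow>
     U \<subseteq> S \<and> (\<forall>(T, \<sigma>)\<in>F. openin T {x \<in> topspace T. \<sigma> x \<in> U})"
proof -
  have inter: "openin T {x \<in> topspace T. \<sigma> x \<in> U \<inter> V}"
    if "openin T {x \<in> topspace T. \<sigma> x \<in> U}" "openin T {x \<in> topspace T. \<sigma> x \<in> V}"
    for T and \<sigma> :: "'b \<Rightarrow> 'a" and U V
  proof -
    have "{x \<in> topspace T. \<sigma> x \<in> U \<inter> V} =
        {x \<in> topspace T. \<sigma> x \<in> U} \<inter> {x \<in> topspace T. \<sigma> x \<in> V}"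
      by blast
    then show ?thesis
      using openin_Int[OF that] by simp
  qed
  have union: "openin T {x \<in> topspace T. \<sigma> x \<in> \<Union>K}"
    if "\<And>U. U \<in> K \<Longrightarrow> openin T {x \<in> topspace T. \<sigma> x \<in> U}" for T and \<sigma> :: "'b \<Rightarrow> 'a" and K
  proof -
    have "{x \<in> topspace T. \<sigma> x \<in> \<Union>K} = (\<Union>U\<in>K. {x \<in> topspace T. \<sigma> x \<in> U})"
      by blast
    then show ?thesis
      using that by auto
  qed
  have "istopology (\<lambda>U. U \<subseteq> S \<and> (\<forall>(T, \<sigma>)\<in>F. openin T {x \<in> topspace T. \<sigma> x \<in> U}))"
    unfolding istopology_def case_prod_unfold
    by (intro conjI allI impI ballI inter union) blast+
  then show ?thesis
    by (simp add: final_topology_def)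
qed

lemma topspace_final_topology:
  assumes "\<And>T \<sigma>. (T, \<sigma>) \<in> F \<Longrightarrow> \<sigma> \<in> topspace T \<rightarrow> S"
  shows "topspace (final_topology S F) = S"
proof (rule subset_antisym)
  show "topspace (final_topology S F) \<subseteq> S"
    using openin_topspace[of "final_topology S F"] by (simp only: openin_final_topology)
  have "openin T {x \<in> topspace T. \<sigma> x \<in> S}" if "(T, \<sigma>) \<in> F" for T \<sigma>
  proof -
    have "{x \<in> topspace T. \<sigma> x \<in> S} = topspace T"
      using assms[OF that] by auto
    then show ?thesis
      by (simp only: openin_topspace)
  qed
  then have "openin (final_topology S F) S"
    by (simp add: openin_final_topology case_prod_unfold)
  then show "S \<subseteq> topspace (final_topology S F)"
    by (rule openin_subset)
qed

lemma continuous_map_into_final_topology: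
  assumes "\<And>T \<sigma>. (T, \<sigma>) \<in> F \<Longrightarrow> \<sigma> \<in> topspace T \<rightarrow> S" and "(T, \<sigma>) \<in> F"
  shows "continuous_map T (final_topology S F) \<sigma>"
proof -
  have "topspace (final_topology S F) = S"
    using assms(1) by (rule topspace_final_topology)
  then show ?thesis
    using assms by (auto simp: continuous_map_def openin_final_topology)
qed

lemma continuous_map_from_final_topology:
  assumes "f \<in> S \<rightarrow> topspace Y"
    and "\<And>T \<sigma>. (T, \<sigma>) \<in> F \<Longrightarrow> \<sigma> \<in> topspace T \<rightarrow> S"
    and "\<And>T \<sigma>. (T, \<sigma>) \<in> F \<Longrightarrow> continuous_map T Y (f \<circ> \<sigma>)"
  shows "continuous_map (final_topology S F) Y f"
proof -
  have topspace: "topspace (final_topology S F) = S"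
    using assms(2) by (rule topspace_final_topology)
  have "openin (final_topology S F) {y \<in> S. f y \<in> U}" if U: "openin Y U" for U
  proof -
    have "openin T {x \<in> topspace T. \<sigma> x \<in> {y \<in> S. f y \<in> U}}" if F: "(T, \<sigma>) \<in> F" for T \<sigma>
    proof -
      have "{x \<in> topspace T. \<sigma> x \<in> {y \<in> S. f y \<in> U}} = {x \<in> topspace T. (f \<circ> \<sigma>) x \<in> U}"
        using assms(2)[OF F] by auto
      then show ?thesis
        using openin_continuous_map_preimage[OF assms(3)[OF F] U] by simp
    qed
    then show ?thesis
      by (simp add: openin_final_topology case_prod_unfold)
  qed
  then show ?thesis
    using assms(1) by (simp add: continuous_map_def topspace)
qed

text \<open>The projection along a compact factor is closed, so the parameters of the violated points
  form a closed set.\<close>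

lemma openin_continuous_map_Ball:
  assumes B: "compact_space B" and J: "closedin B J" and W: "openin X W"
    and G: "continuous_map (prod_topology A B) X G"
  shows "openin A {x \<in> topspace A. \<forall>t\<in>J. G (x, t) \<in> W}"
proof -
  let ?bad = "{p \<in> topspace (prod_topology A B). G p \<in> topspace X - W} \<inter> (topspace A \<times> J)"
  have "closedin (prod_topology A B) ?bad"
    using J W G by (intro closedin_Int closedin_continuous_map_preimage)
      (auto simp: closedin_prod_Times_iff)
  then have "closedin A (fst ` ?bad)"
    using closed_map_fst[OF B] by (auto simp: closed_map_def)
  moreover have "?bad = {p \<in> topspace A \<times> J. G p \<notin> W}"
    using closedin_subset[OF J] continuous_map_funspace[OF G] by auto
  then have "fst ` ?bad = topspace A - {x \<in> topspace A. \<forall>t\<in>J. G (x, t) \<in> W}"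
    by (auto simp: Domain_fst[symmetric])
  ultimately show ?thesis
    by (simp add: openin_closedin_eq)
qed

lemma continuous_map_uncurry:
  assumes B: "regular_space B"
    and g: "\<And>x. x \<in> topspace A \<Longrightarrow> continuous_map B X (g x)"
    and compact_open: "\<And>J W. closedin B J \<Longrightarrow> openin X W \<Longrightarrow> openin A {x \<in> topspace A. g x ` J \<subseteq> W}"
  shows "continuous_map (prod_topology A B) X (\<lambda>p. g (fst p) (snd p))"
  unfolding continuous_map_def
proof (intro conjI allI impI)
  show "(\<lambda>p. g (fst p) (snd p)) \<in> topspace (prod_topology A B) \<rightarrow> topspace X"
    using continuous_map_funspace[OF g] by (auto simp: Pi_iff)
next
  fix W assume W: "openin X W"
  let ?S = "{p \<in> topspace (prod_topology A B). g (fst p) (snd p) \<in> W}"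
  have "\<exists>T. openin (prod_topology A B) T \<and> p \<in> T \<and> T \<subseteq> ?S" if p: "p \<in> ?S" for p
  proof -
    obtain x t where xt: "p = (x, t)" "x \<in> topspace A" "t \<in> topspace B" "g x t \<in> W"
      using p by (cases p) auto
    have "openin B {s \<in> topspace B. g x s \<in> W}"
      using openin_continuous_map_preimage[OF g[OF xt(2)] W] .
    moreover have "t \<in> {s \<in> topspace B. g x s \<in> W}"
      using xt by simp
    moreover have "neighbourhood_base_of (closedin B) B"
      using B by (simp add: neighbourhood_base_of_closedin)
    ultimately obtain V J where V: "openin B V" "t \<in> V" "V \<subseteq> J"
      and J: "closedin B J" "J \<subseteq> {s \<in> topspace B. g x s \<in> W}"
      unfolding neighbourhood_base_of by meson
    define N where "N = {y \<in> topspace A. g y ` J \<subseteq> W}"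
    have "openin (prod_topology A B) (N \<times> V)"
      using compact_open[OF J(1) W] V(1) by (simp add: N_def openin_prod_Times_iff)
    moreover have "p \<in> N \<times> V"
      using xt V J by (auto simp: N_def)
    moreover have "N \<times> V \<subseteq> ?S"
      using V(3) J closedin_subset[OF J(1)] by (auto simp: N_def image_subset_iff)
    ultimately show ?thesis
      by blast
  qed
  then show "openin (prod_topology A B) ?S"
    by (subst openin_subopen) blast
qed

section \<open>Simplices, kelleyfication and path spaces\<close>

lemma simplex_top_eq: "simplex_top n = top_of_set (standard_simplex n)"
  by (simp add: simplex_top_def euclidean_product_topology)

lemma topspace_simplex_top [simp]: "topspace (simplex_top n) = standard_simplex n"
  by (simp add: simplex_top_eq)

lemma topspace_unit_top [simp]: "topspace unit_top = {0..1}"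
  by (simp add: unit_top_def)

lemma compact_space_simplex_top: "compact_space (simplex_top n)"
  unfolding simplex_top_def by (simp add: compact_space_subtopology compactin_standard_simplex)

lemma compact_space_unit_top: "compact_space unit_top"
  by (simp add: unit_top_def compact_space_subtopology)

lemma regular_space_unit_top: "regular_space unit_top"
  by (simp add: unit_top_def regular_space_euclidean regular_space_subtopology)

lemma kdelta_eq_final_topology:
  "kdelta X = final_topology (topspace X)
     {(simplex_top n, \<sigma>) | n \<sigma>. continuous_map (simplex_top n) X \<sigma>}"
  unfolding kdelta_def final_topology_def
  by (rule arg_cong[where f = topology]) force

lemma openin_kdelta:
  "openin (kdelta X) U \<longleftrightarrow> U \<subseteq> topspace X \<and>
     (\<forall>n \<sigma>. continuous_map (simplex_top n) X \<sigma> \<longrightarrow>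
        openin (simplex_top n) {x \<in> standard_simplex n. \<sigma> x \<in> U})"
  unfolding kdelta_eq_final_topology openin_final_topology by force

lemma topspace_kdelta [simp]: "topspace (kdelta X) = topspace X"
  unfolding kdelta_eq_final_topology
  by (rule topspace_final_topology) (auto dest: continuous_map_funspace)

lemma openin_imp_openin_kdelta: "openin X U \<Longrightarrow> openin (kdelta X) U"
  unfolding openin_kdelta
  using openin_continuous_map_preimage openin_subset by fastforce

lemma closedin_imp_closedin_kdelta: "closedin X C \<Longrightarrow> closedin (kdelta X) C"
  by (simp add: closedin_def openin_imp_openin_kdelta)

lemma continuous_map_simplex_kdelta:
  "continuous_map (simplex_top n) X \<sigma> \<Longrightarrow> continuous_map (simplex_top n) (kdelta X) \<sigma>"
  by (simp add: continuous_map_def openin_kdelta)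

definition path_plot :: "nat \<Rightarrow> 'a topology \<Rightarrow> ((nat \<Rightarrow> real) \<Rightarrow> real \<Rightarrow> 'a) \<Rightarrow> bool" where
  "path_plot n X g \<longleftrightarrow> (\<forall>x\<in>standard_simplex n. g x \<in> cpaths X) \<and>
     continuous_map (prod_topology (simplex_top n) unit_top) X (\<lambda>p. g (fst p) (snd p))"

lemma path_plotI:
  assumes G: "continuous_map (prod_topology (simplex_top n) unit_top) X (\<lambda>p. g (fst p) (snd p))"
    and ext: "\<And>x. x \<in> standard_simplex n \<Longrightarrow> g x \<in> extensional {0..1}"
  shows "path_plot n X g"
proof -
  have "continuous_map unit_top X (g x)" if x: "x \<in> standard_simplex n" for x
  proof -
    have "continuous_map unit_top (prod_topology (simplex_top n) unit_top) (\<lambda>t. (x, t))"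
      using x by (simp add: continuous_map_pairwise o_def)
    from continuous_map_compose[OF this G] show ?thesis
      by (simp add: o_def)
  qed
  then show ?thesis
    using G ext by (simp add: path_plot_def cpaths_def)
qed

lemma path_top_eq_final_topology:
  "path_top X = final_topology (cpaths X) {(simplex_top n, g) | n g. path_plot n X g}"
  unfolding path_top_def final_topology_def path_plot_def
  by (rule arg_cong[where f = topology]) force

lemma topspace_path_top [simp]: "topspace (path_top X) = cpaths X"
  unfolding path_top_eq_final_topology
  by (rule topspace_final_topology) (auto simp: path_plot_def)

lemma openin_path_top_compact_open:
  assumes J: "closedin unit_top J" and W: "openin X W"
  shows "openin (path_top X) {\<gamma> \<in> cpaths X. \<gamma> ` J \<subseteq> W}"
proof -
  have "openin (simplex_top n) {x \<in> standard_simplex n. g x \<in> {\<gamma> \<in> cpaths X. \<gamma> ` J \<subseteq> W}}"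
    if g: "path_plot n X g" for n g
  proof -
    have "{x \<in> standard_simplex n. g x \<in> {\<gamma> \<in> cpaths X. \<gamma> ` J \<subseteq> W}} =
        {x \<in> standard_simplex n. \<forall>t\<in>J. g x t \<in> W}"
      using g by (auto simp: path_plot_def)
    moreover have "continuous_map (prod_topology (simplex_top n) unit_top) X
        (\<lambda>p. g (fst p) (snd p))"
      using g by (simp add: path_plot_def)
    from openin_continuous_map_Ball[OF compact_space_unit_top J W this]
    have "openin (simplex_top n) {x \<in> standard_simplex n. \<forall>t\<in>J. g x t \<in> W}"
      by simp
    ultimately show ?thesis
      by simp
  qed
  then show ?thesis
    unfolding path_top_eq_final_topology openin_final_topology by auto
qed

text \<open>The topology of the path space refines the compact-open topology, so a continuous map into
  it has a continuous adjoint although it is not assumed to be a plot.\<close>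

lemma path_plot_iff_continuous_map:
  "path_plot n X g \<longleftrightarrow> continuous_map (simplex_top n) (path_top X) g"
proof
  assume "path_plot n X g"
  then show "continuous_map (simplex_top n) (path_top X) g"
    unfolding path_top_eq_final_topology
    by (intro continuous_map_into_final_topology) (auto simp: path_plot_def)
next
  assume g: "continuous_map (simplex_top n) (path_top X) g"
  then have cpath: "g x \<in> cpaths X" if "x \<in> standard_simplex n" for x
    using continuous_map_funspace that by fastforce
  have "continuous_map (prod_topology (simplex_top n) unit_top) X (\<lambda>p. g (fst p) (snd p))"
  proof (rule continuous_map_uncurry[OF regular_space_unit_top])
    show "continuous_map unit_top X (g x)" if "x \<in> topspace (simplex_top n)" for x
      using cpath that by (simp add: cpaths_def)
    fix J W assume "closedin unit_top J" "openin X W"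
    from openin_continuous_map_preimage[OF g openin_path_top_compact_open[OF this]]
    show "openin (simplex_top n) {x \<in> topspace (simplex_top n). g x ` J \<subseteq> W}"
      using cpath by (simp cong: conj_cong)
  qed
  with cpath show "path_plot n X g"
    by (simp add: path_plot_def)
qed

lemma path_plot_subtopology:
  assumes "path_plot n X g" "\<And>x t. x \<in> standard_simplex n \<Longrightarrow> t \<in> {0..1} \<Longrightarrow> g x t \<in> S"
  shows "path_plot n (subtopology X S) g"
  using assms by (auto simp: path_plot_def cpaths_def continuous_map_in_subtopology)

section \<open>Execution paths\<close>

lemma pmap_apply [simp]: "t \<in> {0..1} \<Longrightarrow> pmap f \<gamma> t = f (\<gamma> t)"
  by (simp add: pmap_def)

lemma pmap_extensional [simp]: "pmap f \<gamma> \<in> extensional {0..1}"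
  by (simp add: pmap_def)

lemma pmap_cong: "(\<And>t. t \<in> {0..1} \<Longrightarrow> f (\<gamma> t) = g (\<delta> t)) \<Longrightarrow> pmap f \<gamma> = pmap g \<delta>"
  by (auto simp: pmap_def restrict_def)

lemma pmap_comp: "pmap (g \<circ> f) \<gamma> = pmap g (pmap f \<gamma>)"
  by (rule pmap_cong) simp

lemma image_pmap [simp]: "pmap f \<gamma> ` {0..1} = f ` \<gamma> ` {0..1}"
  by (auto simp: pmap_def)

lemma pmap_eq_self:
  assumes "\<gamma> \<in> extensional {0..1}" "\<And>t. t \<in> {0..1} \<Longrightarrow> f (\<gamma> t) = \<gamma> t"
  shows "pmap f \<gamma> = \<gamma>"
  using assms by (intro extensionalityI[of _ "{0..1}"]) auto

lemma cpaths_image_subset: "\<gamma> \<in> cpaths X \<Longrightarrow> \<gamma> ` {0..1} \<subseteq> topspace X"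
  using continuous_map_image_subset_topspace by (fastforce simp: cpaths_def)

lemma cpaths_in_topspace: "\<gamma> \<in> cpaths X \<Longrightarrow> t \<in> {0..1} \<Longrightarrow> \<gamma> t \<in> topspace X"
  using cpaths_image_subset by blast

lemma inj_on_pmap:
  assumes "inj_on f (topspace X)"
  shows "inj_on (pmap f) (cpaths X)"
proof (rule inj_onI)
  fix \<gamma> \<delta> assume \<gamma>: "\<gamma> \<in> cpaths X" and \<delta>: "\<delta> \<in> cpaths X" and eq: "pmap f \<gamma> = pmap f \<delta>"
  have "\<gamma> t = \<delta> t" if "t \<in> {0..1}" for t
    using fun_cong[OF eq, of t] cpaths_in_topspace[OF \<gamma> that] cpaths_in_topspace[OF \<delta> that] that
    by (simp add: inj_on_eq_iff[OF assms])
  then show "\<gamma> = \<delta>"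
    using \<gamma> \<delta> by (intro extensionalityI[of _ "{0..1}"]) (auto simp: cpaths_def)
qed

lemma path_plot_pmap:
  assumes g: "path_plot n X g" and h: "continuous_map X Y h"
  shows "path_plot n Y (\<lambda>x. pmap h (g x))"
proof (rule path_plotI)
  have "continuous_map (prod_topology (simplex_top n) unit_top) Y (h \<circ> (\<lambda>p. g (fst p) (snd p)))"
    using assms continuous_map_compose unfolding path_plot_def by blast
  then show "continuous_map (prod_topology (simplex_top n) unit_top) Y
      (\<lambda>p. pmap h (g (fst p)) (snd p))"
    by (rule continuous_map_eq) auto
qed simp

lemma path_plot_embedding_lift:
  assumes h: "embedding_map X Y h" and g: "path_plot n Y g"
    and im: "\<And>x t. x \<in> standard_simplex n \<Longrightarrow> t \<in> {0..1} \<Longrightarrow> g x t \<in> h ` topspace X"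
  obtains g' where "path_plot n X g'" "\<And>x. x \<in> standard_simplex n \<Longrightarrow> g x = pmap h (g' x)"
proof -
  obtain r where "homeomorphic_maps X (subtopology Y (h ` topspace X)) h r"
    using h by (auto simp: embedding_map_def homeomorphic_map_maps)
  then have r: "continuous_map (subtopology Y (h ` topspace X)) X r"
    and hr: "\<And>y. y \<in> topspace Y \<inter> h ` topspace X \<Longrightarrow> h (r y) = y"
    by (auto simp: homeomorphic_maps_def)
  have "path_plot n (subtopology Y (h ` topspace X)) g"
    using g im by (rule path_plot_subtopology)
  then have "path_plot n X (\<lambda>x. pmap r (g x))"
    using r by (rule path_plot_pmap)
  moreover have "g x = pmap h (pmap r (g x))" if x: "x \<in> standard_simplex n" for x
  proof -
    have gx: "g x \<in> cpaths Y"
      using g x by (simp add: path_plot_def)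
    have "(h \<circ> r) (g x t) = g x t" if "t \<in> {0..1}" for t
      using hr[of "g x t"] cpaths_in_topspace[OF gx that] im[OF x that] by simp
    then have "pmap (h \<circ> r) (g x) = g x"
      using gx by (intro pmap_eq_self) (auto simp: cpaths_def)
    then show ?thesis
      by (simp add: pmap_comp)
  qed
  ultimately show ?thesis
    using that by blast
qed

lemma md_paths_cpaths: "is_mdspace X \<Longrightarrow> \<gamma> \<in> md_paths X \<Longrightarrow> \<gamma> \<in> cpaths (md_top X)"
  by (auto simp: is_mdspace_def)

definition exec_plot :: "nat \<Rightarrow> 'a mdspace \<Rightarrow> ((nat \<Rightarrow> real) \<Rightarrow> real \<Rightarrow> 'a) \<Rightarrow> bool" where
  "exec_plot n X g \<longleftrightarrow>
     path_plot n (md_top X) g \<and> (\<exists>a b. g \<in> standard_simplex n \<rightarrow> exec_paths_ab X a b)"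

lemma exec_plot_md_paths: "exec_plot n X g \<Longrightarrow> g \<in> standard_simplex n \<rightarrow> md_paths X"
  by (auto simp: exec_plot_def exec_paths_ab_def)

lemma exec_plot_iff_states:
  assumes "is_mdspace X"
  shows "exec_plot n X g \<longleftrightarrow> path_plot n (md_top X) g \<and>
     (\<exists>a\<in>md_states X. \<exists>b\<in>md_states X. g \<in> standard_simplex n \<rightarrow> exec_paths_ab X a b)"
proof -
  have "a \<in> md_states X \<and> b \<in> md_states X"
    if g: "g \<in> standard_simplex n \<rightarrow> exec_paths_ab X a b" for a b
  proof -
    obtain x where "x \<in> standard_simplex n"
      using nonempty_standard_simplex by blast
    then have "g x \<in> md_paths X" "g x 0 = a" "g x 1 = b"
      using g by (auto simp: exec_paths_ab_def)
    then show ?thesis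
      using assms by (auto simp: is_mdspace_def)
  qed
  then show ?thesis
    unfolding exec_plot_def by blast
qed

lemma openin_dsub_path_top:
  assumes "S \<subseteq> cpaths X"
  shows "openin (dsub (path_top X) S) (U \<inter> S) \<longleftrightarrow>
     (\<forall>n g. path_plot n X g \<and> g \<in> standard_simplex n \<rightarrow> S \<longrightarrow>
        openin (simplex_top n) {x \<in> standard_simplex n. g x \<in> U})"
proof -
  have "{x \<in> standard_simplex n. g x \<in> U \<inter> S} = {x \<in> standard_simplex n. g x \<in> U}"
    if "g \<in> standard_simplex n \<rightarrow> S" for n g
    using that by auto
  moreover have "cpaths X \<inter> S = S"
    using assms by blast
  ultimately show ?thesis
    by (simp add: dsub_def openin_kdelta continuous_map_in_subtopology path_plot_iff_continuous_map
        cong: conj_cong)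
qed

lemma exec_top_eq_final_topology:
  assumes X: "is_mdspace X"
  shows "exec_top X = final_topology (md_paths X) {(simplex_top n, g) | n g. exec_plot n X g}"
proof -
  have "exec_paths_ab X a b \<subseteq> cpaths (md_top X)" for a b
    using X by (auto simp: exec_paths_ab_def is_mdspace_def)
  then have "(\<forall>a\<in>md_states X. \<forall>b\<in>md_states X.
        openin (dsub (path_top (md_top X)) (exec_paths_ab X a b)) (U \<inter> exec_paths_ab X a b)) \<longleftrightarrow>
      (\<forall>n g. exec_plot n X g \<longrightarrow> openin (simplex_top n) {x \<in> standard_simplex n. g x \<in> U})" for U
    by (simp add: openin_dsub_path_top exec_plot_iff_states[OF X]) blast
  then show ?thesis
    unfolding exec_top_def final_topology_def
    by (intro arg_cong[where f = topology]) force
qed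

lemma topspace_exec_top [simp]: "is_mdspace X \<Longrightarrow> topspace (exec_top X) = md_paths X"
  unfolding exec_top_eq_final_topology
  by (rule topspace_final_topology) (use exec_plot_md_paths in fastforce)

lemma openin_exec_top:
  assumes "is_mdspace X"
  shows "openin (exec_top X) U \<longleftrightarrow> U \<subseteq> md_paths X \<and>
     (\<forall>n g. exec_plot n X g \<longrightarrow> openin (simplex_top n) {x \<in> standard_simplex n. g x \<in> U})"
  unfolding exec_top_eq_final_topology[OF assms] openin_final_topology by force

lemma exec_plot_pmap:
  assumes "exec_plot n X g" "md_map X Y h"
  shows "exec_plot n Y (\<lambda>x. pmap h (g x))"
proof -
  obtain a b where "g \<in> standard_simplex n \<rightarrow> exec_paths_ab X a b"
    using assms(1) by (auto simp: exec_plot_def)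
  then have "(\<lambda>x. pmap h (g x)) \<in> standard_simplex n \<rightarrow> exec_paths_ab Y (h a) (h b)"
    using assms(2) by (auto simp: exec_paths_ab_def md_map_def Pi_iff)
  then show ?thesis
    using assms by (auto simp: exec_plot_def md_map_def intro: path_plot_pmap)
qed

lemma continuous_map_exec_top_pmap:
  assumes X: "is_mdspace X" and Y: "is_mdspace Y" and h: "md_map X Y h"
  shows "continuous_map (exec_top X) (exec_top Y) (pmap h)"
  unfolding exec_top_eq_final_topology[OF X]
proof (rule continuous_map_from_final_topology)
  show "pmap h \<in> md_paths X \<rightarrow> topspace (exec_top Y)"
    using h Y by (auto simp: md_map_def)
  fix T \<sigma> assume "(T, \<sigma>) \<in> {(simplex_top n, g) | n g. exec_plot n X g}"
  then obtain n where T: "T = simplex_top n" and \<sigma>: "exec_plot n X \<sigma>"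
    by blast
  from \<sigma> show "\<sigma> \<in> topspace T \<rightarrow> md_paths X"
    by (simp add: T exec_plot_md_paths)
  have "exec_plot n Y (pmap h \<circ> \<sigma>)"
    using exec_plot_pmap[OF \<sigma> h] by (simp add: o_def)
  then show "continuous_map T (exec_top Y) (pmap h \<circ> \<sigma>)"
    unfolding exec_top_eq_final_topology[OF Y] T
    by (intro continuous_map_into_final_topology) (use exec_plot_md_paths in fastforce)+
qed

lemma reparam_image: "\<phi> \<in> reparam \<Longrightarrow> \<phi> ` {0..1} = {0..1}"
  using homeomorphic_imp_surjective_map by (fastforce simp: reparam_def)

lemma reparam_in_unit: "\<phi> \<in> reparam \<Longrightarrow> t \<in> {0..1} \<Longrightarrow> \<phi> t \<in> {0..1}"
  using reparam_image by blast

lemma pmap_reparam: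
  "\<phi> \<in> reparam \<Longrightarrow> restrict (pmap f \<gamma> \<circ> \<phi>) {0..1} = pmap f (restrict (\<gamma> \<circ> \<phi>) {0..1})"
  using reparam_in_unit by (fastforce simp: pmap_def restrict_def)

lemma pmap_ncomp: "ncomp (pmap f \<gamma>) (pmap f \<delta>) = pmap f (ncomp \<gamma> \<delta>)"
  by (auto simp: pmap_def ncomp_def restrict_def fun_eq_iff)

lemma image_reparam: "\<phi> \<in> reparam \<Longrightarrow> (\<gamma> \<circ> \<phi>) ` {0..1} = \<gamma> ` {0..1}"
  unfolding image_comp[symmetric] by (simp only: reparam_image)

lemma image_ncomp:
  assumes "\<gamma> 1 = \<delta> 0"
  shows "ncomp \<gamma> \<delta> ` {0..1} = \<gamma> ` {0..1} \<union> \<delta> ` {0..1}"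
proof (rule subset_antisym)
  show "ncomp \<gamma> \<delta> ` {0..1} \<subseteq> \<gamma> ` {0..1} \<union> \<delta> ` {0..1}"
    by (auto simp: ncomp_def)
  have "\<gamma> t \<in> ncomp \<gamma> \<delta> ` {0..1}" if "t \<in> {0..1}" for t
    using that by (intro image_eqI[of _ _ "t / 2"]) (auto simp: ncomp_def)
  moreover have "\<delta> t \<in> ncomp \<gamma> \<delta> ` {0..1}" if "t \<in> {0..1}" for t
    using that assms
    by (intro image_eqI[of _ _ "(t + 1) / 2"]) (auto simp: ncomp_def add_divide_distrib)
  ultimately show "\<gamma> ` {0..1} \<union> \<delta> ` {0..1} \<subseteq> ncomp \<gamma> \<delta> ` {0..1}"
    by blast
qed

lemma path_closed_pmap_image:
  assumes P: "path_closed P" "P \<subseteq> cpaths X" and f: "inj_on f (topspace X)"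
  shows "path_closed (pmap f ` P)"
  unfolding path_closed_def
proof (intro conjI ballI impI)
  fix \<gamma> \<phi> assume "\<gamma> \<in> pmap f ` P" "\<phi> \<in> reparam"
  then show "restrict (\<gamma> \<circ> \<phi>) {0..1} \<in> pmap f ` P"
    using P(1) by (auto simp: pmap_reparam path_closed_def)
next
  fix \<gamma>1 \<gamma>2 assume "\<gamma>1 \<in> pmap f ` P" "\<gamma>2 \<in> pmap f ` P" and eq: "\<gamma>1 1 = \<gamma>2 0"
  then obtain \<delta>1 \<delta>2 where \<delta>: "\<delta>1 \<in> P" "\<gamma>1 = pmap f \<delta>1" "\<delta>2 \<in> P" "\<gamma>2 = pmap f \<delta>2"
    by blast
  then have "\<delta>1 1 \<in> topspace X" "\<delta>2 0 \<in> topspace X"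
    using P(2) by (auto intro: cpaths_in_topspace)
  then have "\<delta>1 1 = \<delta>2 0"
    using eq \<delta> f by (simp add: inj_on_eq_iff)
  then show "ncomp \<gamma>1 \<gamma>2 \<in> pmap f ` P"
    using P(1) \<delta> by (simp add: pmap_ncomp path_closed_def)
qed

lemma path_closed_if_image_subset:
  assumes "path_closed P"
  shows "path_closed {\<gamma>. \<gamma> ` {0..1} \<subseteq> V \<longrightarrow> \<gamma> \<in> P}"
  using assms unfolding path_closed_def
  by (simp del: o_apply add: image_reparam image_ncomp)

lemma path_closed_UN_mono:
  fixes I :: "'i::linorder set"
  assumes closed: "\<And>i. i \<in> I \<Longrightarrow> path_closed (P i)"
    and mono: "\<And>i j. i \<in> I \<Longrightarrow> j \<in> I \<Longrightarrow> i \<le> j \<Longrightarrow> P i \<subseteq> P j"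
  shows "path_closed (\<Union>i\<in>I. P i)"
  unfolding path_closed_def
proof (intro conjI ballI impI)
  fix \<gamma> \<phi> assume "\<gamma> \<in> (\<Union>i\<in>I. P i)" "\<phi> \<in> reparam"
  then show "restrict (\<gamma> \<circ> \<phi>) {0..1} \<in> (\<Union>i\<in>I. P i)"
    using closed by (auto simp: path_closed_def)
next
  fix \<gamma>1 \<gamma>2 assume "\<gamma>1 \<in> (\<Union>i\<in>I. P i)" "\<gamma>2 \<in> (\<Union>i\<in>I. P i)" and eq: "\<gamma>1 1 = \<gamma>2 0"
  then obtain i j where ij: "i \<in> I" "\<gamma>1 \<in> P i" "j \<in> I" "\<gamma>2 \<in> P j"
    by blast
  then have "max i j \<in> I" "\<gamma>1 \<in> P (max i j)" "\<gamma>2 \<in> P (max i j)"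
    using mono[of i j] mono[of j i] by (auto simp: max_def not_le less_imp_le subset_iff)
  moreover from this have "ncomp \<gamma>1 \<gamma>2 \<in> P (max i j)"
    using closed eq by (simp add: path_closed_def)
  ultimately show "ncomp \<gamma>1 \<gamma>2 \<in> (\<Union>i\<in>I. P i)"
    by blast
qed

lemma gen_paths_superset: "S \<subseteq> gen_paths S"
  by (auto simp: gen_paths_def)

lemma gen_paths_least: "S \<subseteq> P \<Longrightarrow> path_closed P \<Longrightarrow> gen_paths S \<subseteq> P"
  by (auto simp: gen_paths_def)

section \<open>Globes\<close>

definition glob_proj :: "(nat \<Rightarrow> real) \<times> real \<Rightarrow> glob_pt" where
  "glob_proj p = glob_pt (fst p) (snd p)"

definition glob_quotient :: "(nat \<Rightarrow> real) set \<Rightarrow> glob_pt topology" where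
  "glob_quotient Z = final_topology (glob_carrier Z) {(top_of_set (Z \<times> {0..1}), glob_proj)}"

lemma glob_top_eq: "glob_top Z = kdelta (glob_quotient Z)"
proof -
  have "prod_topology (top_of_set Z) unit_top = top_of_set (Z \<times> {0..1})"
    by (simp add: unit_top_def flip: subtopology_Times)
  then show ?thesis
    by (simp add: glob_top_def glob_quotient_def final_topology_def glob_proj_def)
qed

lemma glob_carrier_eq: "glob_carrier Z = {Inl False, Inl True} \<union> glob_proj ` (Z \<times> {0..1})"
  by (simp add: glob_carrier_def glob_proj_def[abs_def])

lemma glob_proj_in_carrier: "glob_proj \<in> Z \<times> {0..1} \<rightarrow> glob_carrier Z"
  by (auto simp: glob_carrier_eq)

lemma glob_pt_in_carrier: "z \<in> Z \<Longrightarrow> t \<in> {0..1} \<Longrightarrow> glob_pt z t \<in> glob_carrier Z"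
  using funcset_mem[OF glob_proj_in_carrier, of "(z, t)" Z] by (simp add: glob_proj_def)

lemma glob_carrier_mono: "Z \<subseteq> W \<Longrightarrow> glob_carrier Z \<subseteq> glob_carrier W"
  by (auto simp: glob_carrier_def)

lemma Inr_in_glob_carrier: "Inr p \<in> glob_carrier Z \<longleftrightarrow> fst p \<in> Z \<and> 0 < snd p \<and> snd p < 1"
  by (cases p) (auto simp: glob_carrier_def glob_pt_def image_iff)

lemma topspace_glob_quotient [simp]: "topspace (glob_quotient Z) = glob_carrier Z"
  unfolding glob_quotient_def
  by (rule topspace_final_topology) (use glob_proj_in_carrier in auto)

lemma topspace_glob_top [simp]: "topspace (glob_top Z) = glob_carrier Z"
  by (simp add: glob_top_eq)

lemma continuous_map_glob_proj:
  assumes "Z \<subseteq> W"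
  shows "continuous_map (top_of_set (Z \<times> {0..1})) (glob_quotient W) glob_proj"
proof (rule continuous_map_from_subtopology_mono)
  show "continuous_map (top_of_set (W \<times> {0..1})) (glob_quotient W) glob_proj"
    unfolding glob_quotient_def
    by (rule continuous_map_into_final_topology) (use glob_proj_in_carrier in auto)
  show "Z \<times> {0..1} \<subseteq> W \<times> {0..1}"
    using assms by blast
qed

text \<open>The factor \<open>t (1 - t)\<close> makes these coordinates constant on the two collapsed ends.\<close>

fun glob_coords :: "glob_pt \<Rightarrow> (nat \<Rightarrow> real) \<times> real" where
  "glob_coords (Inl b) = (\<lambda>i. 0, of_bool b)"
| "glob_coords (Inr (z, t)) = (\<lambda>i. t * (1 - t) * z i, t)"

lemma glob_coords_glob_proj:
  "glob_coords \<circ> glob_proj = (\<lambda>p. (\<lambda>i. snd p * (1 - snd p) * fst p i, snd p))"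
  by (auto simp: glob_proj_def glob_pt_def)

lemma inj_on_glob_coords: "inj_on glob_coords (glob_carrier Z)"
proof (rule inj_onI)
  fix a b assume "a \<in> glob_carrier Z" "b \<in> glob_carrier Z" "glob_coords a = glob_coords b"
  then show "a = b"
    by (cases a rule: glob_coords.cases; cases b rule: glob_coords.cases)
      (auto simp: Inr_in_glob_carrier fun_eq_iff)
qed

lemma continuous_map_glob_coords: "continuous_map (glob_quotient Z) euclidean glob_coords"
proof -
  have "continuous_on (Z \<times> {0..1}) (\<lambda>p. (\<lambda>i. snd p * (1 - snd p) * fst p i, snd p))"
    by (intro continuous_intros continuous_on_coordinatewise_then_product
        continuous_on_product_then_coordinatewise[OF continuous_on_fst[OF continuous_on_id]])
  then show ?thesis
    unfolding glob_quotient_def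
    by (intro continuous_map_from_final_topology)
      (use glob_proj_in_carrier in \<open>auto simp: glob_coords_glob_proj\<close>)
qed

lemma Hausdorff_space_glob_quotient: "Hausdorff_space (glob_quotient Z)"
  by (rule Hausdorff_space_injective_preimage[OF _ continuous_map_glob_coords])
    (simp_all add: inj_on_glob_coords)

lemma t1_space_glob_top: "t1_space (glob_top Z)"
  using Hausdorff_imp_t1_space[OF Hausdorff_space_glob_quotient, of Z] unfolding glob_top_eq
  by (rule t1_space_expansive[rotated -1]) (simp_all add: openin_imp_openin_kdelta)

definition simplex_covered :: "'a::topological_space set \<Rightarrow> bool" where
  "simplex_covered S \<longleftrightarrow> (\<exists>n \<T>. finite \<T> \<and>
     (\<forall>\<tau>\<in>\<T>. continuous_on (standard_simplex n) \<tau>) \<and> S = (\<Union>\<tau>\<in>\<T>. \<tau> ` standard_simplex n))"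

lemma compactin_glob_plot:
  assumes cont: "continuous_on (standard_simplex n) \<tau>" and im: "\<tau> ` standard_simplex n \<subseteq> Z \<times> {0..1}"
    and ZW: "Z \<subseteq> W" and C: "closedin (glob_top Z) C"
  shows "compactin (glob_quotient W) (C \<inter> glob_proj ` \<tau> ` standard_simplex n)"
proof -
  have \<tau>: "continuous_map (simplex_top n) (top_of_set (Z \<times> {0..1})) \<tau>"
    using cont im by (auto simp: simplex_top_eq continuous_map_in_subtopology)
  note plot = continuous_map_compose[OF \<tau> continuous_map_glob_proj]
  let ?K = "{x \<in> standard_simplex n. (glob_proj \<circ> \<tau>) x \<in> C}"
  have "continuous_map (simplex_top n) (glob_top Z) (glob_proj \<circ> \<tau>)"
    unfolding glob_top_eq by (intro continuous_map_simplex_kdelta plot subset_refl)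
  from closedin_continuous_map_preimage[OF this C] have "closedin (simplex_top n) ?K"
    by simp
  then have "compactin (simplex_top n) ?K"
    by (rule closedin_compact_space[OF compact_space_simplex_top])
  then have "compactin (glob_quotient W) ((glob_proj \<circ> \<tau>) ` ?K)"
    using plot[OF ZW] by (rule image_compactin)
  moreover have "(glob_proj \<circ> \<tau>) ` ?K = C \<inter> glob_proj ` \<tau> ` standard_simplex n"
    by auto
  ultimately show ?thesis
    by simp
qed

text \<open>A closed subset of the kelleyfied globe of \<open>Z\<close> is the union of finitely many images of compact
  subsets of simplices, so it is compact in every larger globe.\<close>

lemma closedin_glob_top_mono:
  assumes "simplex_covered (Z \<times> {0..1::real})" and ZW: "Z \<subseteq> W" and C: "closedin (glob_top Z) C"
  shows "closedin (glob_top W) C"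
proof -
  obtain n and \<T> :: "((nat \<Rightarrow> real) \<Rightarrow> (nat \<Rightarrow> real) \<times> real) set"
    where "finite \<T>" and cont: "\<And>\<tau>. \<tau> \<in> \<T> \<Longrightarrow> continuous_on (standard_simplex n) \<tau>"
    and cover: "Z \<times> {0..1} = (\<Union>\<tau>\<in>\<T>. \<tau> ` standard_simplex n)"
    using assms(1) unfolding simplex_covered_def by blast
  have "compactin (glob_quotient W) (C \<inter> glob_proj ` \<tau> ` standard_simplex n)" if "\<tau> \<in> \<T>" for \<tau>
  proof (rule compactin_glob_plot[OF cont[OF that] _ ZW C])
    show "\<tau> ` standard_simplex n \<subseteq> Z \<times> {0..1}"
      unfolding cover using that by (rule UN_upper)
  qed
  then have "compactin (glob_quotient W) (\<Union>\<tau>\<in>\<T>. C \<inter> glob_proj ` \<tau> ` standard_simplex n)"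
    using \<open>finite \<T>\<close> by (intro compactin_Union finite_imageI) auto
  moreover have "compactin (glob_quotient W) (C \<inter> {Inl False, Inl True})"
    by (rule finite_imp_compactin) (auto simp: glob_carrier_eq)
  ultimately have "compactin (glob_quotient W)
      (C \<inter> {Inl False, Inl True} \<union> (\<Union>\<tau>\<in>\<T>. C \<inter> glob_proj ` \<tau> ` standard_simplex n))"
    by (intro compactin_Un)
  moreover have "C \<subseteq> {Inl False, Inl True} \<union> (\<Union>\<tau>\<in>\<T>. glob_proj ` \<tau> ` standard_simplex n)"
    using closedin_subset[OF C] unfolding topspace_glob_top glob_carrier_eq cover image_UN .
  then have "C \<inter> {Inl False, Inl True} \<union> (\<Union>\<tau>\<in>\<T>. C \<inter> glob_proj ` \<tau> ` standard_simplex n) = C"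
    unfolding Int_UN_distrib[symmetric] Int_Un_distrib[symmetric] by (rule Int_absorb2)
  ultimately have "compactin (glob_quotient W) C"
    by (simp only:)
  then show ?thesis
    unfolding glob_top_eq
    by (intro closedin_imp_closedin_kdelta compactin_imp_closedin Hausdorff_space_glob_quotient)
qed

text \<open>Square roots of barycentric coordinates parametrize the orthant of the sphere given by the
  signs \<open>\<epsilon>\<close>. The last coordinate, cut off at \<open>1/2\<close> to keep the rescaling continuous, carries the
  height; the part cut off is added to the first coordinate.\<close>

definition orthant_coord :: "nat \<Rightarrow> (nat \<Rightarrow> real) \<Rightarrow> nat \<Rightarrow> real" where
  "orthant_coord n x i = (if n \<le> i then 0 else
     (x i + (if i = 0 then x n - min (1/2) (x n) else 0)) / (1 - min (1/2) (x n)))"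

definition cylinder_patch :: "nat \<Rightarrow> (nat \<Rightarrow> real) \<Rightarrow> (nat \<Rightarrow> real) \<Rightarrow> (nat \<Rightarrow> real) \<times> real" where
  "cylinder_patch n \<epsilon> x = (\<lambda>i. \<epsilon> i * sqrt (orthant_coord n x i), 2 * min (1/2) (x n))"

lemma continuous_on_cylinder_patch: "continuous_on S (cylinder_patch n \<epsilon>)"
proof -
  have coord: "continuous_on S (\<lambda>x. x i)" for i :: nat and S :: "(nat \<Rightarrow> real) set"
    by (rule continuous_on_product_then_coordinatewise[OF continuous_on_id])
  have "1 - min (1/2) r \<noteq> 0" for r :: real
    by (simp add: min_def)
  then have "continuous_on S (\<lambda>x. orthant_coord n x i)" for i
    unfolding orthant_coord_def
    by (cases "n \<le> i"; cases "i = 0") (auto intro!: continuous_intros coord)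
  then show ?thesis
    unfolding cylinder_patch_def
    by (intro continuous_intros continuous_on_coordinatewise_then_product coord)
qed

lemma cylinder_patch_in:
  assumes n: "0 < n" and \<epsilon>: "\<epsilon> \<in> {..<n} \<rightarrow> {-1, 1}" and x: "x \<in> standard_simplex n"
  shows "cylinder_patch n \<epsilon> x \<in> sphere_m1 n \<times> {0..1}"
proof -
  define w where "w = min (1/2) (x n)"
  have w: "0 \<le> w" "w \<le> 1/2" "w \<le> x n" and x0: "0 \<le> x i" for i
    using x by (auto simp: w_def standard_simplex_def)
  have coord: "orthant_coord n x i = (x i + (if i = 0 then x n - w else 0)) / (1 - w)"
    if "i < n" for i
    using that by (simp add: orthant_coord_def w_def)
  have "(\<Sum>i<n. x i + (if i = 0 then x n - w else 0)) = (\<Sum>i\<le>n. x i) - w"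
    using n by (simp add: sum.distrib lessThan_Suc_atMost[symmetric])
  also have "\<dots> = 1 - w"
    using x by (simp add: standard_simplex_def)
  finally have "(\<Sum>i<n. orthant_coord n x i) = 1"
    using w by (simp add: coord flip: sum_divide_distrib)
  moreover have "(\<epsilon> i * sqrt (orthant_coord n x i))\<^sup>2 = orthant_coord n x i" if "i < n" for i
  proof -
    have "0 \<le> orthant_coord n x i"
      using w x0[of i] by (simp add: coord[OF that])
    moreover have "(\<epsilon> i)\<^sup>2 = 1"
      using \<epsilon> that by (auto simp: Pi_iff power2_eq_1_iff)
    ultimately show ?thesis
      by (simp add: power_mult_distrib)
  qed
  ultimately have "(\<Sum>i<n. (\<epsilon> i * sqrt (orthant_coord n x i))\<^sup>2) = 1"
    by simp
  then show ?thesis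
    using w by (auto simp: cylinder_patch_def sphere_m1_def orthant_coord_def w_def)
qed

lemma cylinder_patch_surj:
  assumes n: "0 < n" and z: "z \<in> sphere_m1 n" and t: "t \<in> {0..1}"
  obtains \<epsilon> x where "\<epsilon> \<in> {..<n} \<rightarrow>\<^sub>E {-1, 1}" "x \<in> standard_simplex n"
    "cylinder_patch n \<epsilon> x = (z, t)"
proof
  define \<epsilon> where "\<epsilon> = restrict (\<lambda>i. if z i < 0 then -1 else 1 :: real) {..<n}"
  define x where "x i = (if i < n then (1 - t / 2) * (z i)\<^sup>2 else if i = n then t / 2 else 0)" for i
  have zsum: "(\<Sum>i<n. (z i)\<^sup>2) = 1" and z0: "\<And>i. n \<le> i \<Longrightarrow> z i = 0"
    using z by (auto simp: sphere_m1_def)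
  show "\<epsilon> \<in> {..<n} \<rightarrow>\<^sub>E {-1, 1}"
    by (auto simp: \<epsilon>_def)
  show "x \<in> standard_simplex n"
  proof -
    have "(\<Sum>i\<le>n. x i) = (\<Sum>i<n. (1 - t / 2) * (z i)\<^sup>2) + t / 2"
      by (simp add: x_def lessThan_Suc_atMost[symmetric])
    also have "\<dots> = 1"
      by (simp add: zsum flip: sum_distrib_left)
    finally have sum: "(\<Sum>i\<le>n. x i) = 1" .
    moreover have nonneg: "0 \<le> x i" for i
      using t by (simp add: x_def)
    moreover have "x i \<le> 1" for i
    proof (cases "i \<le> n")
      case True
      then show ?thesis
        using member_le_sum[of i "{..n}" x] nonneg sum by simp
    qed (simp add: x_def)
    ultimately show ?thesis
      by (simp add: standard_simplex_def x_def)
  qed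
  have "orthant_coord n x i = (z i)\<^sup>2" for i
    using t z0[of i] by (simp add: orthant_coord_def x_def)
  moreover have "\<epsilon> i * \<bar>z i\<bar> = z i" for i
    using z0[of i] by (simp add: \<epsilon>_def not_less)
  ultimately show "cylinder_patch n \<epsilon> x = (z, t)"
    using t by (simp add: cylinder_patch_def x_def)
qed

lemma simplex_covered_sphere_cylinder: "simplex_covered (sphere_m1 n \<times> {0..1::real})"
proof (cases "n = 0")
  case True
  then have "sphere_m1 n \<times> {0..1::real} = (\<Union>\<tau>\<in>{}. \<tau> ` standard_simplex 0)"
    by (simp add: sphere_m1_def)
  then show ?thesis
    unfolding simplex_covered_def by blast
next
  case False
  let ?\<E> = "{..<n} \<rightarrow>\<^sub>E {-1, 1 :: real}"
  have "sphere_m1 n \<times> {0..1} = (\<Union>\<tau>\<in>cylinder_patch n ` ?\<E>. \<tau> ` standard_simplex n)"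
  proof (intro subset_antisym subsetI)
    fix p assume p: "p \<in> sphere_m1 n \<times> {0..1::real}"
    obtain \<epsilon> x where "\<epsilon> \<in> ?\<E>" "x \<in> standard_simplex n" "cylinder_patch n \<epsilon> x = p"
      by (rule cylinder_patch_surj[of n "fst p" "snd p"]) (use False p in auto)
    then show "p \<in> (\<Union>\<tau>\<in>cylinder_patch n ` ?\<E>. \<tau> ` standard_simplex n)"
      by blast
  next
    fix p assume "p \<in> (\<Union>\<tau>\<in>cylinder_patch n ` ?\<E>. \<tau> ` standard_simplex n)"
    then obtain \<epsilon> x where "\<epsilon> \<in> {..<n} \<rightarrow> {-1, 1}" "x \<in> standard_simplex n" "p = cylinder_patch n \<epsilon> x"
      by (auto simp: PiE_iff)
    then show "p \<in> sphere_m1 n \<times> {0..1}"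
      using cylinder_patch_in False by blast
  qed
  moreover have "finite (cylinder_patch n ` ?\<E>)"
    by (simp add: finite_PiE)
  moreover have "\<forall>\<tau>\<in>cylinder_patch n ` ?\<E>. continuous_on (standard_simplex n) \<tau>"
    by (simp add: continuous_on_cylinder_patch)
  ultimately show ?thesis
    unfolding simplex_covered_def by meson
qed

lemma sphere_subset_disk: "sphere_m1 n \<subseteq> disk n"
  by (auto simp: sphere_m1_def disk_def)

lemma closedin_glob_sphere_imp_disk:
  "closedin (glob_top (sphere_m1 n)) C \<Longrightarrow> closedin (glob_top (disk n)) C"
  by (rule closedin_glob_top_mono[OF simplex_covered_sphere_cylinder sphere_subset_disk])

section \<open>Closed embeddings of multipointed d-spaces\<close>

definition md_closed_embedding :: "'a mdspace \<Rightarrow> 'b mdspace \<Rightarrow> ('a \<Rightarrow> 'b) \<Rightarrow> bool" where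
  "md_closed_embedding X Y f \<longleftrightarrow> md_map X Y f \<and>
     inj_on f (topspace (md_top X)) \<and> closed_map (md_top X) (md_top Y) f \<and>
     (\<forall>\<gamma>\<in>md_paths Y. \<gamma> ` {0..1} \<subseteq> f ` topspace (md_top X) \<longrightarrow> \<gamma> \<in> pmap f ` md_paths X)"

lemma md_path_in_topspace:
  "is_mdspace X \<Longrightarrow> \<gamma> \<in> md_paths X \<Longrightarrow> t \<in> {0..1} \<Longrightarrow> \<gamma> t \<in> topspace (md_top X)"
  by (blast intro: cpaths_in_topspace md_paths_cpaths)

lemma pmap_factor:
  assumes "is_mdspace X" "\<gamma> \<in> md_paths X" "\<And>x. x \<in> topspace (md_top X) \<Longrightarrow> h x = g (f x)"
  shows "pmap h \<gamma> = pmap g (pmap f \<gamma>)"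
  using assms by (intro pmap_cong) (auto dest: md_path_in_topspace)

lemma md_closed_embedding_imp_md_map: "md_closed_embedding X Y f \<Longrightarrow> md_map X Y f"
  and md_closed_embedding_imp_inj_on: "md_closed_embedding X Y f \<Longrightarrow> inj_on f (topspace (md_top X))"
  and md_closed_embedding_imp_closed_map:
    "md_closed_embedding X Y f \<Longrightarrow> closed_map (md_top X) (md_top Y) f"
  and md_closed_embedding_reflect: "md_closed_embedding X Y f \<Longrightarrow> \<gamma> \<in> md_paths Y \<Longrightarrow>
    \<gamma> ` {0..1} \<subseteq> f ` topspace (md_top X) \<Longrightarrow> \<gamma> \<in> pmap f ` md_paths X"
  by (simp_all add: md_closed_embedding_def)

lemma md_closed_embedding_imp_continuous_map:
  "md_closed_embedding X Y f \<Longrightarrow> continuous_map (md_top X) (md_top Y) f"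
  by (simp add: md_closed_embedding_def md_map_def)

lemma md_closed_embedding_imp_embedding_map:
  "md_closed_embedding X Y f \<Longrightarrow> embedding_map (md_top X) (md_top Y) f"
  by (intro injective_closed_imp_embedding_map md_closed_embedding_imp_continuous_map
      md_closed_embedding_imp_closed_map md_closed_embedding_imp_inj_on)

lemma md_closed_embedding_in_topspace:
  "md_closed_embedding X Y f \<Longrightarrow> x \<in> topspace (md_top X) \<Longrightarrow> f x \<in> topspace (md_top Y)"
  using continuous_map_funspace[OF md_closed_embedding_imp_continuous_map, of X Y f] by blast

lemma md_closed_embedding_id:
  assumes X: "is_mdspace X" and f: "\<And>x. x \<in> topspace (md_top X) \<Longrightarrow> f x = x"
  shows "md_closed_embedding X X f"
proof -
  have pmap: "pmap f \<gamma> = \<gamma>" if "\<gamma> \<in> md_paths X" for \<gamma>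
    using md_paths_cpaths[OF X that] md_path_in_topspace[OF X that] f
    by (intro pmap_eq_self) (auto simp: cpaths_def)
  have "continuous_map (md_top X) (md_top X) f"
    by (rule continuous_map_eq[where f = id]) (simp_all add: f)
  moreover have "closed_map (md_top X) (md_top X) f"
    by (rule closed_map_eq[where f = id]) (simp_all add: closed_map_id f)
  moreover have "f ` md_states X \<subseteq> md_states X"
    using X f by (auto simp: is_mdspace_def)
  ultimately show ?thesis
    using f pmap by (auto simp: md_closed_embedding_def md_map_def inj_on_def image_iff)
qed

lemma pmap_reflect_factor:
  assumes X: "is_mdspace X" and Y: "is_mdspace Y" and f: "md_closed_embedding X Y f"
    and g: "inj_on g (topspace (md_top Y))"
    and h: "\<And>x. x \<in> topspace (md_top X) \<Longrightarrow> h x = g (f x)"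
    and \<delta>: "\<delta> \<in> md_paths Y" "pmap g \<delta> ` {0..1} \<subseteq> h ` topspace (md_top X)"
  shows "pmap g \<delta> \<in> pmap h ` md_paths X"
proof -
  have "\<delta> t \<in> f ` topspace (md_top X)" if t: "t \<in> {0..1}" for t
  proof -
    obtain x where x: "x \<in> topspace (md_top X)" "g (\<delta> t) = g (f x)"
      using \<delta>(2) t h by fastforce
    moreover have "f x \<in> topspace (md_top Y)"
      by (rule md_closed_embedding_in_topspace[OF f x(1)])
    ultimately have "\<delta> t = f x"
      using inj_on_eq_iff[OF g] md_path_in_topspace[OF Y \<delta>(1) t] by blast
    with x(1) show ?thesis
      by blast
  qed
  then obtain \<epsilon> where \<epsilon>: "\<epsilon> \<in> md_paths X" "\<delta> = pmap f \<epsilon>"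
    using md_closed_embedding_reflect[OF f \<delta>(1)] by blast
  have "pmap h \<epsilon> = pmap g \<delta>"
    unfolding \<epsilon>(2) using X \<epsilon>(1) h by (rule pmap_factor)
  with \<epsilon>(1) show ?thesis
    by (metis imageI)
qed

lemma md_closed_embedding_comp:
  assumes X: "is_mdspace X" and Y: "is_mdspace Y"
    and f: "md_closed_embedding X Y f" and g: "md_closed_embedding Y Z g"
    and h: "\<And>x. x \<in> topspace (md_top X) \<Longrightarrow> h x = g (f x)"
  shows "md_closed_embedding X Z h"
  unfolding md_closed_embedding_def
proof (intro conjI ballI impI)
  have "continuous_map (md_top X) (md_top Z) (g \<circ> f)"
    by (intro continuous_map_compose[where X' = "md_top Y"]
        md_closed_embedding_imp_continuous_map f g)
  then have "continuous_map (md_top X) (md_top Z) h"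
    by (rule continuous_map_eq) (simp add: h)
  moreover have "pmap h \<gamma> = pmap g (pmap f \<gamma>)" if "\<gamma> \<in> md_paths X" for \<gamma>
    using X that h by (rule pmap_factor)
  moreover have "h x = g (f x)" if "x \<in> md_states X" for x
    using X that h by (auto simp: is_mdspace_def)
  ultimately show "md_map X Z h"
    using md_closed_embedding_imp_md_map[OF f] md_closed_embedding_imp_md_map[OF g]
    by (simp add: md_map_def image_subset_iff)
  have "inj_on (g \<circ> f) (topspace (md_top X))"
    using md_closed_embedding_imp_inj_on[OF g] md_closed_embedding_in_topspace[OF f]
    by (intro comp_inj_on md_closed_embedding_imp_inj_on[OF f]) (auto intro: inj_on_subset)
  then show "inj_on h (topspace (md_top X))"
    by (simp add: h cong: inj_on_cong)
  have "closed_map (md_top X) (md_top Z) (g \<circ> f)"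
    by (intro closed_map_compose[where X' = "md_top Y"] md_closed_embedding_imp_closed_map f g)
  then show "closed_map (md_top X) (md_top Z) h"
    by (rule closed_map_eq) (simp add: h)
  fix \<gamma> assume \<gamma>: "\<gamma> \<in> md_paths Z" "\<gamma> ` {0..1} \<subseteq> h ` topspace (md_top X)"
  have "h ` topspace (md_top X) \<subseteq> g ` topspace (md_top Y)"
    using md_closed_embedding_in_topspace[OF f] h by (simp add: image_subset_iff)
  then obtain \<delta> where \<delta>: "\<delta> \<in> md_paths Y" "\<gamma> = pmap g \<delta>"
    using md_closed_embedding_reflect[OF g \<gamma>(1)] \<gamma>(2) by blast
  show "\<gamma> \<in> pmap h ` md_paths X"
    using X Y f md_closed_embedding_imp_inj_on[OF g] h \<delta>(1) \<gamma>(2)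
    unfolding \<delta>(2) by (rule pmap_reflect_factor)
qed

lemma exec_paths_ab_reflect:
  assumes X: "is_mdspace X" and h: "md_closed_embedding X Y h" and \<gamma>: "\<gamma> \<in> cpaths (md_top X)"
    and ab: "a \<in> topspace (md_top X)" "b \<in> topspace (md_top X)"
    and path: "pmap h \<gamma> \<in> exec_paths_ab Y (h a) (h b)"
  shows "\<gamma> \<in> exec_paths_ab X a b"
proof -
  note inj = md_closed_embedding_imp_inj_on[OF h]
  have "pmap h \<gamma> \<in> md_paths Y" "pmap h \<gamma> ` {0..1} \<subseteq> h ` topspace (md_top X)"
    using path cpaths_image_subset[OF \<gamma>] by (auto simp: exec_paths_ab_def)
  then obtain \<delta> where \<delta>: "\<delta> \<in> md_paths X" "pmap h \<gamma> = pmap h \<delta>"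
    using md_closed_embedding_reflect[OF h] by blast
  then have "\<gamma> = \<delta>"
    using inj_onD[OF inj_on_pmap[OF inj]] \<gamma> md_paths_cpaths[OF X] by blast
  moreover have "h (\<gamma> 0) = h a" "h (\<gamma> 1) = h b"
    using path by (auto simp: exec_paths_ab_def)
  then have "\<gamma> 0 = a" "\<gamma> 1 = b"
    using inj_onD[OF inj] cpaths_in_topspace[OF \<gamma>] ab by auto
  ultimately show ?thesis
    using \<delta>(1) by (simp add: exec_paths_ab_def)
qed

lemma exec_plot_md_closed_embedding_lift:
  assumes X: "is_mdspace X" and h: "md_closed_embedding X Y h" and g: "exec_plot n Y g"
    and im: "\<And>x t. x \<in> standard_simplex n \<Longrightarrow> t \<in> {0..1} \<Longrightarrow> g x t \<in> h ` topspace (md_top X)"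
  obtains g' where "exec_plot n X g'" "\<And>x. x \<in> standard_simplex n \<Longrightarrow> g x = pmap h (g' x)"
proof -
  obtain g' where g': "path_plot n (md_top X) g'"
    and eq: "\<And>x. x \<in> standard_simplex n \<Longrightarrow> g x = pmap h (g' x)"
    by (rule path_plot_embedding_lift[OF md_closed_embedding_imp_embedding_map[OF h], of n g])
      (use g im in \<open>auto simp: exec_plot_def\<close>)
  then have cpath: "g' x \<in> cpaths (md_top X)" if "x \<in> standard_simplex n" for x
    using that by (simp add: path_plot_def)
  obtain x\<^sub>0 where x\<^sub>0: "x\<^sub>0 \<in> standard_simplex n"
    using nonempty_standard_simplex by blast
  let ?a = "g' x\<^sub>0 0" and ?b = "g' x\<^sub>0 1"
  obtain a b where ab: "g \<in> standard_simplex n \<rightarrow> exec_paths_ab Y a b"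
    using g by (auto simp: exec_plot_def)
  then have "g x\<^sub>0 0 = a" "g x\<^sub>0 1 = b"
    using x\<^sub>0 by (auto simp: exec_paths_ab_def)
  then have "h ?a = a" "h ?b = b"
    by (auto simp: eq[OF x\<^sub>0])
  have "g' x \<in> exec_paths_ab X ?a ?b" if x: "x \<in> standard_simplex n" for x
  proof (rule exec_paths_ab_reflect[OF X h cpath[OF x]])
    show "pmap h (g' x) \<in> exec_paths_ab Y (h ?a) (h ?b)"
      unfolding \<open>h ?a = a\<close> \<open>h ?b = b\<close> using funcset_mem[OF ab x] eq[OF x] by simp
  qed (use cpaths_in_topspace[OF cpath[OF x\<^sub>0]] in auto)
  then have "exec_plot n X g'"
    using g' by (auto simp: exec_plot_def)
  then show ?thesis
    using that eq by blast
qed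

section \<open>Attaching a globe\<close>

locale globe_attachment =
  fixes n :: nat and g :: "glob_pt \<Rightarrow> 'a" and X Y :: "'a mdspace"
    and f :: "'a \<Rightarrow> 'a" and gh :: "glob_pt \<Rightarrow> 'a"
  assumes pushout: "glob_pushout n g X Y f gh" and mdspace_X: "is_mdspace X"
begin

abbreviation boundary :: "glob_pt set" where
  "boundary \<equiv> glob_carrier (sphere_m1 n)"

abbreviation cell :: "glob_pt set" where
  "cell \<equiv> glob_carrier (disk n) - boundary"

lemma topspace_pushout: "topspace (md_top Y) = f ` topspace (md_top X) \<union> gh ` glob_carrier (disk n)"
  and openin_pushout: "openin (md_top Y) U \<longleftrightarrow> U \<subseteq> topspace (md_top Y) \<and>
        openin (md_top X) {x \<in> topspace (md_top X). f x \<in> U} \<and>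
        openin (glob_top (disk n)) {x \<in> glob_carrier (disk n). gh x \<in> U}"
  and states_pushout: "md_states Y = f ` md_states X \<union> gh ` md_states (Glob (disk n))"
  and paths_pushout: "md_paths Y =
        gen_paths (pmap f ` md_paths X \<union> pmap gh ` md_paths (Glob (disk n)))"
  and inj_on_f: "inj_on f (topspace (md_top X))"
  and inj_on_cell: "inj_on gh cell"
  and cell_disjoint: "f ` topspace (md_top X) \<inter> gh ` cell = {}"
  and gh_boundary: "a \<in> boundary \<Longrightarrow> gh a = f (g a)"
  and md_map_g: "md_map (Glob (sphere_m1 n)) X g"
  using pushout by (auto simp: glob_pushout_def Let_def)

lemma boundary_subset: "boundary \<subseteq> glob_carrier (disk n)"
  by (rule glob_carrier_mono[OF sphere_subset_disk])

lemma continuous_map_g: "continuous_map (glob_top (sphere_m1 n)) (md_top X) g"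
  using md_map_g by (simp add: md_map_def Glob_def)

lemma g_in_topspace: "a \<in> boundary \<Longrightarrow> g a \<in> topspace (md_top X)"
  using continuous_map_funspace[OF continuous_map_g] by auto

lemma closedin_pushoutI:
  assumes "C \<subseteq> topspace (md_top Y)"
    and "closedin (md_top X) {x \<in> topspace (md_top X). f x \<in> C}"
    and "closedin (glob_top (disk n)) {x \<in> glob_carrier (disk n). gh x \<in> C}"
  shows "closedin (md_top Y) C"
proof -
  have "{x \<in> topspace (md_top X). f x \<in> topspace (md_top Y) - C} =
      topspace (md_top X) - {x \<in> topspace (md_top X). f x \<in> C}"
    and "{x \<in> glob_carrier (disk n). gh x \<in> topspace (md_top Y) - C} =
      glob_carrier (disk n) - {x \<in> glob_carrier (disk n). gh x \<in> C}"
    using topspace_pushout by auto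
  then show ?thesis
    using assms by (simp add: closedin_def openin_pushout)
qed

lemma closed_map_f: "closed_map (md_top X) (md_top Y) f"
  unfolding closed_map_def
proof (intro allI impI closedin_pushoutI)
  fix C assume C: "closedin (md_top X) C"
  then have CX: "C \<subseteq> topspace (md_top X)"
    by (rule closedin_subset)
  then show "f ` C \<subseteq> topspace (md_top Y)"
    using topspace_pushout by blast
  have "{x \<in> topspace (md_top X). f x \<in> f ` C} = C"
    using CX inj_on_image_mem_iff[OF inj_on_f] by blast
  with C show "closedin (md_top X) {x \<in> topspace (md_top X). f x \<in> f ` C}"
    by simp
  have "gh x \<in> f ` C \<longleftrightarrow> g x \<in> C" if "x \<in> boundary" for x
    using gh_boundary[OF that] g_in_topspace[OF that] CX inj_on_image_mem_iff[OF inj_on_f] by metis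
  then have "{x \<in> glob_carrier (disk n). gh x \<in> f ` C} = {x \<in> boundary. g x \<in> C}"
    using boundary_subset cell_disjoint CX by blast
  moreover have "closedin (glob_top (sphere_m1 n)) {x \<in> boundary. g x \<in> C}"
    using closedin_continuous_map_preimage[OF continuous_map_g C] by simp
  ultimately show "closedin (glob_top (disk n)) {x \<in> glob_carrier (disk n). gh x \<in> f ` C}"
    by (simp add: closedin_glob_sphere_imp_disk)
qed

lemma t1_space_pushout:
  assumes "t1_space (md_top X)"
  shows "t1_space (md_top Y)"
  unfolding t1_space_closedin_singleton
proof
  fix y assume "y \<in> topspace (md_top Y)"
  then consider (base) x where "x \<in> topspace (md_top X)" "y = f x"
    | (cell) b where "b \<in> cell" "y = gh b"
    using topspace_pushout gh_boundary g_in_topspace by blast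
  then show "closedin (md_top Y) {y}"
  proof cases
    case (base x)
    then have "closedin (md_top Y) (f ` {x})"
      using closed_map_f closedin_t1_singleton[OF assms] unfolding closed_map_def by blast
    then show ?thesis
      by (simp add: base)
  next
    case (cell b)
    show ?thesis
    proof (rule closedin_pushoutI)
      show "{y} \<subseteq> topspace (md_top Y)"
        using cell topspace_pushout by blast
      have "{x \<in> topspace (md_top X). f x \<in> {y}} = {}"
        using cell cell_disjoint by blast
      then show "closedin (md_top X) {x \<in> topspace (md_top X). f x \<in> {y}}"
        by (simp only: closedin_empty)
      have "{x \<in> glob_carrier (disk n). gh x \<in> {y}} = {b}"
        using cell cell_disjoint inj_on_cell gh_boundary g_in_topspace
        by (auto simp: inj_on_def) blast+
      then show "closedin (glob_top (disk n)) {x \<in> glob_carrier (disk n). gh x \<in> {y}}"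
        using cell by (simp add: closedin_t1_singleton t1_space_glob_top)
    qed
  qed
qed

text \<open>A globe path over an interior point of the disk leaves the image of \<open>X\<close> at its midpoint.\<close>

lemma globe_path_reflect:
  assumes \<delta>: "\<delta> \<in> md_paths (Glob (disk n))"
    and im: "pmap gh \<delta> ` {0..1} \<subseteq> f ` topspace (md_top X)"
  shows "pmap gh \<delta> \<in> pmap f ` md_paths X"
proof -
  obtain z \<phi> where z: "z \<in> disk n" and \<phi>: "\<phi> \<in> reparam"
    and \<delta>_eq: "\<delta> = restrict (\<lambda>t. glob_pt z (\<phi> t)) {0..1}"
    using \<delta> by (auto simp: Glob_def)
  have "1/2 \<in> \<phi> ` {0..1}"
    using reparam_image[OF \<phi>] by simp
  then obtain t where "t \<in> {0..1}" "\<delta> t = Inr (z, 1/2)"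
    by (auto simp: \<delta>_eq glob_pt_def)
  then have "gh (Inr (z, 1/2)) \<in> f ` topspace (md_top X)"
    using im by (metis image_subset_iff pmap_apply)
  then have "Inr (z, 1/2) \<notin> cell"
    using cell_disjoint by blast
  then have sphere: "z \<in> sphere_m1 n"
    using z by (simp add: Inr_in_glob_carrier)
  then have "pmap g \<delta> \<in> md_paths X"
    using md_map_g \<phi> by (auto simp: md_map_def Glob_def \<delta>_eq image_subset_iff)
  moreover have "pmap gh \<delta> = pmap f (pmap g \<delta>)"
    using sphere reparam_in_unit[OF \<phi>]
    by (intro pmap_cong) (simp add: \<delta>_eq gh_boundary glob_pt_in_carrier)
  ultimately show ?thesis
    by blast
qed

lemma md_closed_embedding_f: "md_closed_embedding X Y f"
  unfolding md_closed_embedding_def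
proof (intro conjI ballI impI)
  have "continuous_map (md_top X) (md_top Y) f"
    using topspace_pushout by (auto simp: continuous_map_def openin_pushout)
  moreover have "pmap f ` md_paths X \<subseteq> md_paths Y"
    unfolding paths_pushout by (rule order_trans[OF Un_upper1 gen_paths_superset])
  ultimately show "md_map X Y f"
    by (simp add: md_map_def states_pushout)
  fix \<gamma> assume \<gamma>: "\<gamma> \<in> md_paths Y" and im: "\<gamma> ` {0..1} \<subseteq> f ` topspace (md_top X)"
  let ?P = "{\<gamma>. \<gamma> ` {0..1} \<subseteq> f ` topspace (md_top X) \<longrightarrow> \<gamma> \<in> pmap f ` md_paths X}"
  have "path_closed ?P"
    using mdspace_X inj_on_f
    by (intro path_closed_if_image_subset path_closed_pmap_image) (auto simp: is_mdspace_def)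
  moreover have "pmap f ` md_paths X \<union> pmap gh ` md_paths (Glob (disk n)) \<subseteq> ?P"
    using globe_path_reflect by (intro Un_least subsetI CollectI impI) (auto simp del: image_pmap)
  ultimately have "md_paths Y \<subseteq> ?P"
    unfolding paths_pushout by (intro gen_paths_least)
  with \<gamma> im show "\<gamma> \<in> pmap f ` md_paths X"
    by blast
qed (fact inj_on_f closed_map_f)+

end

section \<open>Colimits of closed embeddings\<close>

locale closed_top_colimit =
  fixes I :: "'i::linorder set" and T :: "'i \<Rightarrow> 'a topology" and f :: "'i \<Rightarrow> 'i \<Rightarrow> 'a \<Rightarrow> 'a"
    and S :: "'b topology" and h :: "'i \<Rightarrow> 'a \<Rightarrow> 'b"
  assumes f_continuous: "i \<in> I \<Longrightarrow> j \<in> I \<Longrightarrow> i \<le> j \<Longrightarrow> continuous_map (T i) (T j) (f i j)"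
    and f_inj: "i \<in> I \<Longrightarrow> j \<in> I \<Longrightarrow> i \<le> j \<Longrightarrow> inj_on (f i j) (topspace (T i))"
    and f_closed: "i \<in> I \<Longrightarrow> j \<in> I \<Longrightarrow> i \<le> j \<Longrightarrow> closed_map (T i) (T j) (f i j)"
    and h_f: "i \<in> I \<Longrightarrow> j \<in> I \<Longrightarrow> i \<le> j \<Longrightarrow> x \<in> topspace (T i) \<Longrightarrow> h j (f i j x) = h i x"
    and colimit: "top_colimit I T f S h"
begin

abbreviation stage :: "'i \<Rightarrow> 'b set" where
  "stage i \<equiv> h i ` topspace (T i)"

lemma f_in_topspace:
  assumes "i \<in> I" "j \<in> I" "i \<le> j" "x \<in> topspace (T i)"
  shows "f i j x \<in> topspace (T j)"
  using continuous_map_funspace[OF f_continuous[OF assms(1-3)]] assms(4) by blast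

lemma topspace_colimit: "topspace S = (\<Union>i\<in>I. stage i)"
  using colimit by (simp add: top_colimit_def)

lemma h_in_topspace: "i \<in> I \<Longrightarrow> x \<in> topspace (T i) \<Longrightarrow> h i x \<in> topspace S"
  unfolding topspace_colimit by blast

lemma h_image_f:
  assumes "i \<in> I" "j \<in> I" "i \<le> j" "C \<subseteq> topspace (T i)"
  shows "h j ` f i j ` C = h i ` C"
  unfolding image_image using assms h_f[OF assms(1-3)] by (intro image_cong) auto

lemma stage_mono:
  assumes "i \<in> I" "j \<in> I" "i \<le> j"
  shows "stage i \<subseteq> stage j"
proof -
  have "f i j ` topspace (T i) \<subseteq> topspace (T j)"
    using f_in_topspace[OF assms] by blast
  then show ?thesis
    unfolding h_image_f[OF assms subset_refl, symmetric] by (rule image_mono)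
qed

lemma closedin_colimit_iff:
  "closedin S C \<longleftrightarrow> C \<subseteq> topspace S \<and> (\<forall>i\<in>I. closedin (T i) {x \<in> topspace (T i). h i x \<in> C})"
proof -
  have "{x \<in> topspace (T i). h i x \<in> topspace S - C} =
      topspace (T i) - {x \<in> topspace (T i). h i x \<in> C}" if "i \<in> I" for i
    using h_in_topspace[OF that] by auto
  moreover have "openin S U \<longleftrightarrow> U \<subseteq> topspace S \<and>
      (\<forall>i\<in>I. openin (T i) {x \<in> topspace (T i). h i x \<in> U})" for U
    using colimit by (simp add: top_colimit_def)
  ultimately show ?thesis
    by (simp add: closedin_def)
qed

lemma h_inj:
  assumes i: "i \<in> I"
  shows "inj_on (h i) (topspace (T i))"
proof (rule inj_onI)
  fix x y assume xy: "x \<in> topspace (T i)" "y \<in> topspace (T i)" "h i x = h i y"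
  moreover have "\<forall>i\<in>I. \<forall>j\<in>I. \<forall>x\<in>topspace (T i). \<forall>y\<in>topspace (T j).
      h i x = h j y \<longrightarrow> (\<exists>k\<in>I. i \<le> k \<and> j \<le> k \<and> f i k x = f j k y)"
    using colimit by (simp add: top_colimit_def)
  ultimately obtain k where k: "k \<in> I" "i \<le> k" "f i k x = f i k y"
    using i by blast
  show "x = y"
    using inj_onD[OF f_inj[OF i k(1,2)] k(3)] xy by blast
qed

lemma h_closed:
  assumes i: "i \<in> I"
  shows "closed_map (T i) S (h i)"
  unfolding closed_map_def
proof (intro allI impI)
  fix C assume C: "closedin (T i) C"
  then have CT: "C \<subseteq> topspace (T i)"
    by (rule closedin_subset)
  have "closedin (T j) {x \<in> topspace (T j). h j x \<in> h i ` C}" if j: "j \<in> I" for j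
  proof (cases "i \<le> j")
    case True
    have fC: "f i j ` C \<subseteq> topspace (T j)"
      using CT f_in_topspace[OF i j True] by blast
    have "{x \<in> topspace (T j). h j x \<in> h i ` C} = f i j ` C"
      using inj_on_image_mem_iff[OF h_inj[OF j] _ fC] fC
      unfolding h_image_f[OF i j True CT, symmetric] by blast
    then show ?thesis
      using f_closed[OF i j True] C by (simp add: closed_map_def)
  next
    case False
    then have ji: "j \<le> i"
      by simp
    have "h j x \<in> h i ` C \<longleftrightarrow> f j i x \<in> C" if x: "x \<in> topspace (T j)" for x
      using inj_on_image_mem_iff[OF h_inj[OF i] f_in_topspace[OF j i ji x] CT] h_f[OF j i ji x]
      by simp
    then have "{x \<in> topspace (T j). h j x \<in> h i ` C} = {x \<in> topspace (T j). f j i x \<in> C}"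
      by blast
    then show ?thesis
      using closedin_continuous_map_preimage[OF f_continuous[OF j i ji] C] by simp
  qed
  moreover have "h i ` C \<subseteq> topspace S"
    using CT h_in_topspace[OF i] by blast
  ultimately show "closedin S (h i ` C)"
    by (simp add: closedin_colimit_iff)
qed

lemma t1_space_colimit:
  assumes "\<And>i. i \<in> I \<Longrightarrow> t1_space (T i)"
  shows "t1_space S"
  unfolding t1_space_closedin_singleton
proof
  fix y assume "y \<in> topspace S"
  then obtain i x where i: "i \<in> I" "x \<in> topspace (T i)" "y = h i x"
    unfolding topspace_colimit by blast
  then have "closedin S (h i ` {x})"
    using h_closed[OF i(1)] closedin_t1_singleton[OF assms[OF i(1)] i(2)]
    unfolding closed_map_def by blast
  with i show "closedin S {y}"
    by simp
qed

lemma closedin_colimit_if_finite_in_stages: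
  assumes T1: "\<And>i. i \<in> I \<Longrightarrow> t1_space (T i)"
    and B: "B \<subseteq> topspace S" "\<And>i. i \<in> I \<Longrightarrow> finite (B \<inter> stage i)"
  shows "closedin S B"
proof -
  have "closedin (T i) {x \<in> topspace (T i). h i x \<in> B}" if i: "i \<in> I" for i
  proof -
    have "finite (topspace (T i) \<inter> h i -` (B \<inter> stage i))"
      using finite_vimage_IntI[OF B(2)[OF i] h_inj[OF i]] by (simp add: Int_commute)
    moreover have "topspace (T i) \<inter> h i -` (B \<inter> stage i) = {x \<in> topspace (T i). h i x \<in> B}"
      by blast
    ultimately show ?thesis
      using T1[OF i] by (simp add: t1_space_closedin_finite)
  qed
  with B(1) show ?thesis
    by (simp add: closedin_colimit_iff)
qed

end

definition md_colimit_cocone ::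
  "'i::linorder set \<Rightarrow> ('i \<Rightarrow> 'a mdspace) \<Rightarrow> ('i \<Rightarrow> 'i \<Rightarrow> 'a \<Rightarrow> 'a) \<Rightarrow> 'b mdspace \<Rightarrow> ('i \<Rightarrow> 'a \<Rightarrow> 'b) \<Rightarrow> bool"
  where
  "md_colimit_cocone I X f Y h \<longleftrightarrow> is_mdspace Y \<and> (\<forall>i\<in>I. md_map (X i) Y (h i)) \<and>
     (\<forall>i\<in>I. \<forall>j\<in>I. i \<le> j \<longrightarrow> (\<forall>x\<in>topspace (md_top (X i)). h j (f i j x) = h i x)) \<and>
     md_colimit I X f Y h"

locale md_closed_colimit =
  fixes I :: "'i::linorder set" and X :: "'i \<Rightarrow> 'a mdspace" and f :: "'i \<Rightarrow> 'i \<Rightarrow> 'a \<Rightarrow> 'a"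
    and Y :: "'b mdspace" and h :: "'i \<Rightarrow> 'a \<Rightarrow> 'b"
  assumes mdspace: "i \<in> I \<Longrightarrow> is_mdspace (X i)"
    and f_embedding: "i \<in> I \<Longrightarrow> j \<in> I \<Longrightarrow> i \<le> j \<Longrightarrow> md_closed_embedding (X i) (X j) (f i j)"
    and cocone: "md_colimit_cocone I X f Y h"

sublocale md_closed_colimit \<subseteq> closed_top_colimit I "\<lambda>i. md_top (X i)" f "md_top Y" h
proof
  show "top_colimit I (\<lambda>i. md_top (X i)) f (md_top Y) h"
    using cocone by (simp add: md_colimit_cocone_def md_colimit_def top_colimit_def)
  fix i j assume ij: "i \<in> I" "j \<in> I" "i \<le> j"
  note embedding = f_embedding[OF ij]
  show "continuous_map (md_top (X i)) (md_top (X j)) (f i j)"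
    by (rule md_closed_embedding_imp_continuous_map[OF embedding])
  show "inj_on (f i j) (topspace (md_top (X i)))"
    by (rule md_closed_embedding_imp_inj_on[OF embedding])
  show "closed_map (md_top (X i)) (md_top (X j)) (f i j)"
    by (rule md_closed_embedding_imp_closed_map[OF embedding])
  show "h j (f i j x) = h i x" if "x \<in> topspace (md_top (X i))" for x
    using cocone ij that by (simp add: md_colimit_cocone_def)
qed

context md_closed_colimit
begin

lemma mdspace_colimit: "is_mdspace Y"
  and md_map_h: "i \<in> I \<Longrightarrow> md_map (X i) Y (h i)"
  using cocone by (simp_all add: md_colimit_cocone_def)

lemma pmap_f_md_paths:
  assumes "i \<in> I" "j \<in> I" "i \<le> j" "\<gamma> \<in> md_paths (X i)"
  shows "pmap (f i j) \<gamma> \<in> md_paths (X j)"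
  using md_closed_embedding_imp_md_map[OF f_embedding[OF assms(1-3)]] assms(4)
  by (auto simp: md_map_def)

lemma pmap_h_f:
  assumes "i \<in> I" "j \<in> I" "i \<le> j" "\<gamma> \<in> md_paths (X i)"
  shows "pmap (h j) (pmap (f i j) \<gamma>) = pmap (h i) \<gamma>"
  using pmap_factor[OF mdspace[OF assms(1)] assms(4), of "h i" "h j" "f i j"] h_f[OF assms(1-3)]
  by simp

lemma pmap_h_md_paths_mono:
  assumes "i \<in> I" "j \<in> I" "i \<le> j"
  shows "pmap (h i) ` md_paths (X i) \<subseteq> pmap (h j) ` md_paths (X j)"
proof (rule image_subsetI)
  fix \<gamma> assume \<gamma>: "\<gamma> \<in> md_paths (X i)"
  then have "pmap (h j) (pmap (f i j) \<gamma>) \<in> pmap (h j) ` md_paths (X j)"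
    by (intro imageI pmap_f_md_paths[OF assms])
  then show "pmap (h i) \<gamma> \<in> pmap (h j) ` md_paths (X j)"
    by (simp only: pmap_h_f[OF assms \<gamma>])
qed

lemma inj_on_pmap_h: "i \<in> I \<Longrightarrow> inj_on (pmap (h i)) (md_paths (X i))"
  by (rule inj_on_subset[OF inj_on_pmap[OF h_inj]]) (use mdspace in \<open>auto simp: is_mdspace_def\<close>)

lemma md_paths_colimit: "md_paths Y = (\<Union>i\<in>I. pmap (h i) ` md_paths (X i))"
proof -
  have "path_closed (\<Union>i\<in>I. pmap (h i) ` md_paths (X i))"
  proof (intro path_closed_UN_mono pmap_h_md_paths_mono)
    fix i assume "i \<in> I"
    then show "path_closed (pmap (h i) ` md_paths (X i))"
      using mdspace h_inj by (intro path_closed_pmap_image) (auto simp: is_mdspace_def)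
  qed
  then have "gen_paths (\<Union>i\<in>I. pmap (h i) ` md_paths (X i)) =
      (\<Union>i\<in>I. pmap (h i) ` md_paths (X i))"
    by (intro subset_antisym gen_paths_superset gen_paths_least subset_refl)
  then show ?thesis
    using cocone by (simp add: md_colimit_cocone_def md_colimit_def)
qed

lemma md_closed_embedding_h:
  assumes i: "i \<in> I"
  shows "md_closed_embedding (X i) Y (h i)"
  unfolding md_closed_embedding_def
proof (intro conjI ballI impI)
  fix \<gamma> assume \<gamma>: "\<gamma> \<in> md_paths Y" "\<gamma> ` {0..1} \<subseteq> stage i"
  then obtain j where j: "j \<in> I" "\<gamma> \<in> pmap (h j) ` md_paths (X j)"
    unfolding md_paths_colimit by blast
  define k where "k = max i j"
  have k: "k \<in> I" "i \<le> k" "j \<le> k"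
    using i j(1) by (auto simp: k_def max_def)
  then obtain \<delta> where \<delta>: "\<delta> \<in> md_paths (X k)" "\<gamma> = pmap (h k) \<delta>"
    using j pmap_h_md_paths_mono[OF j(1) k(1,3)] by blast
  show "\<gamma> \<in> pmap (h i) ` md_paths (X i)"
    unfolding \<delta>(2)
  proof (rule pmap_reflect_factor[OF mdspace mdspace f_embedding h_inj])
    show "pmap (h k) \<delta> ` {0..1} \<subseteq> stage i"
      using \<gamma>(2) \<delta>(2) by simp
  qed (use i k \<delta> h_f in auto)
qed (use i md_map_h h_inj h_closed in auto)

context
  assumes compact_stage: "\<And>K. compactin (md_top Y) K \<Longrightarrow> K \<noteq> {} \<Longrightarrow> \<exists>i\<in>I. K \<subseteq> stage i"
begin

lemma exec_plot_lift_to_stage: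
  assumes g: "exec_plot n Y g"
  obtains i g' where "i \<in> I" "exec_plot n (X i) g'"
    "\<And>x. x \<in> standard_simplex n \<Longrightarrow> g x = pmap (h i) (g' x)"
proof -
  let ?P = "prod_topology (simplex_top n) unit_top" and ?G = "\<lambda>p. g (fst p) (snd p)"
  have "continuous_map ?P (md_top Y) ?G"
    using g by (simp add: exec_plot_def path_plot_def)
  moreover have "compactin ?P (standard_simplex n \<times> {0..1})"
    using compact_space_simplex_top[of n] compact_space_unit_top
    by (simp add: compact_space_def compactin_Times)
  ultimately have "compactin (md_top Y) (?G ` (standard_simplex n \<times> {0..1}))"
    using image_compactin by blast
  moreover have "?G ` (standard_simplex n \<times> {0..1}) \<noteq> {}"
    using nonempty_standard_simplex by auto
  ultimately obtain i where i: "i \<in> I" and "?G ` (standard_simplex n \<times> {0..1}) \<subseteq> stage i"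
    using compact_stage by blast
  then have "g x t \<in> stage i" if "x \<in> standard_simplex n" "t \<in> {0..1}" for x t
    using that by (auto simp: image_subset_iff)
  then obtain g' where "exec_plot n (X i) g'"
    "\<And>x. x \<in> standard_simplex n \<Longrightarrow> g x = pmap (h i) (g' x)"
    using exec_plot_md_closed_embedding_lift[OF mdspace[OF i] md_closed_embedding_h[OF i] g]
    by metis
  with i show ?thesis
    by (rule that)
qed

lemma openin_exec_top_colimit_iff:
  "openin (exec_top Y) U \<longleftrightarrow> U \<subseteq> md_paths Y \<and>
    (\<forall>i\<in>I. openin (exec_top (X i)) {\<gamma> \<in> md_paths (X i). pmap (h i) \<gamma> \<in> U})"
proof (intro iffI conjI ballI)
  assume U: "openin (exec_top Y) U"
  then show "U \<subseteq> md_paths Y"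
    using openin_subset mdspace_colimit by fastforce
  fix i assume i: "i \<in> I"
  have "continuous_map (exec_top (X i)) (exec_top Y) (pmap (h i))"
    by (rule continuous_map_exec_top_pmap[OF mdspace[OF i] mdspace_colimit md_map_h[OF i]])
  from openin_continuous_map_preimage[OF this U]
  show "openin (exec_top (X i)) {\<gamma> \<in> md_paths (X i). pmap (h i) \<gamma> \<in> U}"
    by (simp add: mdspace[OF i])
next
  assume U: "U \<subseteq> md_paths Y \<and>
    (\<forall>i\<in>I. openin (exec_top (X i)) {\<gamma> \<in> md_paths (X i). pmap (h i) \<gamma> \<in> U})"
  have "openin (simplex_top n) {x \<in> standard_simplex n. g x \<in> U}" if g: "exec_plot n Y g" for n g
  proof -
    obtain i g' where i: "i \<in> I" and g': "exec_plot n (X i) g'"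
      and eq: "\<And>x. x \<in> standard_simplex n \<Longrightarrow> g x = pmap (h i) (g' x)"
      using exec_plot_lift_to_stage[OF g] by metis
    have "openin (exec_top (X i)) {\<gamma> \<in> md_paths (X i). pmap (h i) \<gamma> \<in> U}"
      using U i by blast
    then have "openin (simplex_top n)
        {x \<in> standard_simplex n. g' x \<in> {\<gamma> \<in> md_paths (X i). pmap (h i) \<gamma> \<in> U}}"
      using g' unfolding openin_exec_top[OF mdspace[OF i]] by blast
    also have "{x \<in> standard_simplex n. g' x \<in> {\<gamma> \<in> md_paths (X i). pmap (h i) \<gamma> \<in> U}} =
        {x \<in> standard_simplex n. g x \<in> U}"
      using exec_plot_md_paths[OF g'] eq by auto
    finally show ?thesis .
  qed
  with U show "openin (exec_top Y) U"
    by (simp add: openin_exec_top mdspace_colimit)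
qed

lemma exec_top_colimit:
  "top_colimit I (\<lambda>i. exec_top (X i)) (\<lambda>i j. pmap (f i j)) (exec_top Y) (\<lambda>i. pmap (h i))"
proof -
  have "\<exists>k\<in>I. i \<le> k \<and> j \<le> k \<and> pmap (f i k) \<gamma> = pmap (f j k) \<delta>"
    if ij: "i \<in> I" "j \<in> I" and paths: "\<gamma> \<in> md_paths (X i)" "\<delta> \<in> md_paths (X j)"
      and eq: "pmap (h i) \<gamma> = pmap (h j) \<delta>" for i j \<gamma> \<delta>
  proof (intro bexI conjI)
    show k: "max i j \<in> I"
      using ij by (simp add: max_def)
    show "pmap (f i (max i j)) \<gamma> = pmap (f j (max i j)) \<delta>"
      using ij k paths eq
      by (intro inj_onD[OF inj_on_pmap_h[OF k]]) (simp_all add: pmap_f_md_paths pmap_h_f)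
  qed simp_all
  then show ?thesis
    by (simp add: top_colimit_def mdspace mdspace_colimit md_paths_colimit
        openin_exec_top_colimit_iff cong: SUP_cong_simp)
qed

end

end

section \<open>Transfinite towers\<close>

lemma wellorder_trichotomy:
  obtains (least) "is_least \<nu>" | (succ) \<mu> where "is_succ \<mu> \<nu>" | (limit) "is_limit \<nu>"
  unfolding is_least_def is_succ_def is_limit_def by (metis not_le_imp_less)

lemma is_succ_less: "is_succ \<mu> \<nu> \<Longrightarrow> \<mu> < \<nu>"
  by (simp add: is_succ_def)

lemma is_succ_imp_le: "is_succ \<mu> \<nu> \<Longrightarrow> \<rho> < \<nu> \<Longrightarrow> \<rho> \<le> \<mu>"
  unfolding is_succ_def by (metis leD not_le_imp_less)

lemma compactin_finite_if_subsets_closed: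
  assumes K: "compactin X K" "A \<subseteq> K" and closed: "\<And>B. B \<subseteq> A \<Longrightarrow> closedin X B"
  shows "finite A"
proof -
  have A: "closedin X A"
    by (rule closed) simp
  have "x \<notin> X derived_set_of A" if x: "x \<in> A" for x
  proof
    assume "x \<in> X derived_set_of A"
    moreover have "closedin X (A - {x})"
      by (rule closed) blast
    then have "openin X (topspace X - (A - {x}))"
      by (rule openin_diff[OF openin_topspace])
    moreover have "x \<in> topspace X - (A - {x})"
      using x closedin_subset[OF A] by blast
    ultimately obtain y where "y \<noteq> x" "y \<in> A" "y \<in> topspace X - (A - {x})"
      unfolding in_derived_set_of by metis
    then show False
      by blast
  qed
  then have "A \<inter> X derived_set_of A = {}"
    by blast
  moreover have "compactin X A"
    by (rule closed_compactin[OF K A])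
  ultimately show ?thesis
    by (simp add: discrete_compactin_eq_finite)
qed

lemma infinite_accumulates_at_limit:
  fixes R :: "'i::wellorder set"
  assumes "infinite R" "R \<subseteq> {..<\<kappa>}"
  obtains \<mu> where "is_limit \<mu>" "\<mu> \<le> \<kappa>" "infinite (R \<inter> {..<\<mu>})"
    "\<forall>i<\<mu>. finite (R \<inter> {..<i})"
proof
  define \<mu> where "\<mu> = (LEAST \<mu>. infinite (R \<inter> {..<\<mu>}))"
  have "infinite (R \<inter> {..<\<kappa>})"
    using assms by (simp add: Int_absorb2)
  then show inf: "infinite (R \<inter> {..<\<mu>})" and "\<mu> \<le> \<kappa>"
    unfolding \<mu>_def by (rule LeastI, rule Least_le)
  show fin: "\<forall>i<\<mu>. finite (R \<inter> {..<i})"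
    unfolding \<mu>_def using not_less_Least by blast
  show "is_limit \<mu>"
  proof (cases \<mu> rule: wellorder_trichotomy)
    case least
    then have "R \<inter> {..<\<mu>} = {}"
      by (auto simp: is_least_def)
    with inf show ?thesis
      by simp
  next
    case (succ i)
    then have "R \<inter> {..<\<mu>} \<subseteq> insert i (R \<inter> {..<i})"
      using is_succ_imp_le[OF succ] by (auto simp: order_le_less)
    then have "finite (R \<inter> {..<\<mu>})"
      by (rule finite_subset) (simp add: fin is_succ_less[OF succ])
    with inf show ?thesis
      by simp
  qed
qed

locale t1_tower = closed_top_colimit "{..<\<kappa>}" T f S h
  for \<kappa> :: "'i::wellorder" and T :: "'i \<Rightarrow> 'a topology" and f and S :: "'b topology" and h +
  assumes t1_space: "i < \<kappa> \<Longrightarrow> t1_space (T i)"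
    and limit_colimit: "\<mu> < \<kappa> \<Longrightarrow> is_limit \<mu> \<Longrightarrow> closed_top_colimit {..<\<mu>} T f (T \<mu>) (\<lambda>i. f i \<mu>)"
begin

definition rank :: "'b \<Rightarrow> 'i" where
  "rank x = (LEAST i. i < \<kappa> \<and> x \<in> stage i)"

lemma rank_stage: "x \<in> topspace S \<Longrightarrow> rank x < \<kappa> \<and> x \<in> stage (rank x)"
  unfolding rank_def topspace_colimit by (rule LeastI_ex) blast

lemma rank_le: "i < \<kappa> \<Longrightarrow> x \<in> stage i \<Longrightarrow> rank x \<le> i"
  unfolding rank_def by (rule Least_le) blast

lemma closedin_if_finite_in_stages_below_limit:
  assumes \<mu>: "is_limit \<mu>" "\<mu> \<le> \<kappa>"
    and B: "B \<subseteq> (\<Union>i\<in>{..<\<mu>}. stage i)" "\<And>i. i < \<mu> \<Longrightarrow> finite (B \<inter> stage i)"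
  shows "closedin S B"
proof (cases "\<mu> = \<kappa>")
  case True
  then show ?thesis
    using B t1_space by (intro closedin_colimit_if_finite_in_stages) (auto simp: topspace_colimit)
next
  case False
  then have \<mu>: "\<mu> < \<kappa>" "is_limit \<mu>"
    using \<mu> by auto
  then interpret sub: closed_top_colimit "{..<\<mu>}" T f "T \<mu>" "\<lambda>i. f i \<mu>"
    using limit_colimit by blast
  let ?B = "{x \<in> topspace (T \<mu>). h \<mu> x \<in> B}"
  have "closedin (T \<mu>) ?B"
  proof (rule sub.closedin_colimit_if_finite_in_stages)
    fix i assume "i \<in> {..<\<mu>}"
    then have i: "i < \<mu>"
      by simp
    have "h \<mu> ` sub.stage i = stage i"
      using i \<mu> by (intro h_image_f) auto
    then have "h \<mu> ` (?B \<inter> sub.stage i) \<subseteq> B \<inter> stage i"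
      by blast
    then have "finite (h \<mu> ` (?B \<inter> sub.stage i))"
      using B(2)[OF i] by (rule finite_subset)
    moreover have "inj_on (h \<mu>) (?B \<inter> sub.stage i)"
      by (rule inj_on_subset[OF h_inj]) (use \<mu> in auto)
    ultimately show "finite (?B \<inter> sub.stage i)"
      by (rule finite_imageD)
  qed (use \<mu> t1_space in auto)
  then have "closedin S (h \<mu> ` ?B)"
    using h_closed[of \<mu>] \<mu> by (simp add: closed_map_def)
  moreover have "B \<subseteq> stage \<mu>"
    using B(1) stage_mono \<mu> by (meson UN_least lessThan_iff less_imp_le less_trans subset_trans)
  then have "h \<mu> ` ?B = B"
    by blast
  ultimately show ?thesis
    by simp
qed

lemma closedin_if_finite_ranks_below_limit:
  assumes \<mu>: "is_limit \<mu>" "\<mu> \<le> \<kappa>" and A: "A \<subseteq> topspace S" "inj_on rank A" "rank ` A \<subseteq> {..<\<mu>}"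
    and finite: "\<And>i. i < \<mu> \<Longrightarrow> finite (rank ` A \<inter> {..<i})"
  shows "closedin S A"
proof (rule closedin_if_finite_in_stages_below_limit[OF \<mu>])
  show "A \<subseteq> (\<Union>i\<in>{..<\<mu>}. stage i)"
  proof
    fix x assume "x \<in> A"
    then have "rank x \<in> {..<\<mu>}" "x \<in> stage (rank x)"
      using A rank_stage by auto
    then show "x \<in> (\<Union>i\<in>{..<\<mu>}. stage i)"
      by blast
  qed
  fix i assume i: "i < \<mu>"
  have "rank ` (A \<inter> stage i) \<subseteq> insert i (rank ` A \<inter> {..<i})"
  proof
    fix r assume "r \<in> rank ` (A \<inter> stage i)"
    then obtain x where x: "x \<in> A" "x \<in> stage i" "r = rank x"
      by blast
    then have "r \<le> i"
      using rank_le[of i x] i \<mu>(2) by simp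
    with x show "r \<in> insert i (rank ` A \<inter> {..<i})"
      by auto
  qed
  then have "finite (rank ` (A \<inter> stage i))"
    by (rule finite_subset) (simp add: finite[OF i])
  moreover have "inj_on rank (A \<inter> stage i)"
    using A(2) by (rule inj_on_subset) simp
  ultimately show "finite (A \<inter> stage i)"
    by (rule finite_imageD)
qed

text \<open>One point of \<open>K\<close> for each of infinitely many ranks converging to a limit stage would give an
  infinite subset of \<open>K\<close> all of whose subsets are closed.\<close>

lemma finite_rank_compactin:
  assumes K: "compactin S K"
  shows "finite (rank ` K)"
proof (rule ccontr)
  assume "infinite (rank ` K)"
  have KS: "K \<subseteq> topspace S"
    by (rule compactin_subset_topspace[OF K])
  then have "rank ` K \<subseteq> {..<\<kappa>}"
    using rank_stage by auto
  with \<open>infinite (rank ` K)\<close> obtain \<mu> where \<mu>: "is_limit \<mu>" "\<mu> \<le> \<kappa>"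
    and inf: "infinite (rank ` K \<inter> {..<\<mu>})"
    and fin: "\<forall>i<\<mu>. finite (rank ` K \<inter> {..<i})"
    by (rule infinite_accumulates_at_limit)
  obtain A where A: "A \<subseteq> K" "inj_on rank A" "rank ` K \<inter> {..<\<mu>} = rank ` A"
    using subset_image_inj[of "rank ` K \<inter> {..<\<mu>}" rank K] by auto
  have "closedin S B" if B: "B \<subseteq> A" for B
  proof (rule closedin_if_finite_ranks_below_limit[OF \<mu>])
    show "B \<subseteq> topspace S" "rank ` B \<subseteq> {..<\<mu>}" "inj_on rank B"
      using A B KS inj_on_subset by blast+
    show "finite (rank ` B \<inter> {..<i})" if "i < \<mu>" for i
      by (rule finite_subset[OF _ fin[rule_format, OF that]]) (use A(1) B in blast)
  qed
  then have "finite A"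
    by (rule compactin_finite_if_subsets_closed[OF K A(1)])
  with A(3) inf show False
    by simp
qed

lemma compactin_subset_stage:
  assumes K: "compactin S K" "K \<noteq> {}"
  shows "\<exists>i\<in>{..<\<kappa>}. K \<subseteq> stage i"
proof -
  define i where "i = Max (rank ` K)"
  have rank: "rank x < \<kappa> \<and> x \<in> stage (rank x)" if "x \<in> K" for x
    using rank_stage compactin_subset_topspace[OF K(1)] that by blast
  have "i \<in> rank ` K"
    unfolding i_def using finite_rank_compactin[OF K(1)] K(2) by simp
  then have i: "i < \<kappa>"
    using rank by auto
  have "x \<in> stage i" if "x \<in> K" for x
  proof -
    have "rank x \<le> i"
      unfolding i_def using finite_rank_compactin[OF K(1)] that by simp
    then show ?thesis
      using stage_mono[of "rank x" i] rank[OF that] i by auto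
  qed
  with i show ?thesis
    by blast
qed

end

locale globular_tower =
  fixes lam :: "'i::wellorder" and X :: "'i \<Rightarrow> 'a mdspace" and f :: "'i \<Rightarrow> 'i \<Rightarrow> 'a \<Rightarrow> 'a"
  assumes mdspace: "\<nu> < lam \<Longrightarrow> is_mdspace (X \<nu>)"
    and md_map_f: "\<mu> \<le> \<nu> \<Longrightarrow> \<nu> < lam \<Longrightarrow> md_map (X \<mu>) (X \<nu>) (f \<mu> \<nu>)"
    and f_id: "\<nu> < lam \<Longrightarrow> x \<in> topspace (md_top (X \<nu>)) \<Longrightarrow> f \<nu> \<nu> x = x"
    and f_comp: "\<mu> \<le> \<nu> \<Longrightarrow> \<nu> \<le> \<rho> \<Longrightarrow> \<rho> < lam \<Longrightarrow> x \<in> topspace (md_top (X \<mu>)) \<Longrightarrow>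
      f \<nu> \<rho> (f \<mu> \<nu> x) = f \<mu> \<rho> x"
    and least_discrete: "\<nu> < lam \<Longrightarrow> is_least \<nu> \<Longrightarrow> \<exists>E. X \<nu> = md_set E"
    and succ_pushout: "\<nu>' < lam \<Longrightarrow> is_succ \<nu> \<nu>' \<Longrightarrow>
      \<exists>n g gh. glob_pushout n g (X \<nu>) (X \<nu>') (f \<nu> \<nu>') gh"
    and limit_colimit: "\<nu> < lam \<Longrightarrow> is_limit \<nu> \<Longrightarrow> md_colimit {..<\<nu>} X f (X \<nu>) (\<lambda>\<mu>. f \<mu> \<nu>)"
begin

lemma limit_cocone:
  assumes "\<nu> < lam" "is_limit \<nu>"
  shows "md_colimit_cocone {..<\<nu>} X f (X \<nu>) (\<lambda>\<mu>. f \<mu> \<nu>)"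
  using assms mdspace md_map_f limit_colimit f_comp by (simp add: md_colimit_cocone_def less_imp_le)

lemma succ_attachment:
  assumes "\<nu> < lam" "is_succ \<mu> \<nu>"
  obtains n g gh where "globe_attachment n g (X \<mu>) (X \<nu>) (f \<mu> \<nu>) gh"
proof -
  have "is_mdspace (X \<mu>)"
    using mdspace is_succ_less[OF assms(2)] assms(1) less_trans by blast
  then show ?thesis
    using succ_pushout[OF assms] that by (auto simp: globe_attachment_def)
qed

lemma md_closed_embedding_tower: "i \<le> j \<Longrightarrow> j < lam \<Longrightarrow> md_closed_embedding (X i) (X j) (f i j)"
proof (induction j arbitrary: i rule: less_induct)
  case (less j)
  show ?case
  proof (cases "i = j")
    case True
    with less.prems show ?thesis
      by (auto intro: md_closed_embedding_id mdspace f_id)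
  next
    case False
    then have "i < j"
      using less.prems by simp
    show ?thesis
    proof (cases j rule: wellorder_trichotomy)
      case least
      with \<open>i < j\<close> show ?thesis
        by (simp add: is_least_def)
    next
      case (succ k)
      have k: "i \<le> k" "k < j"
        using is_succ_imp_le[OF succ \<open>i < j\<close>] is_succ_less[OF succ] .
      have "k < lam" "i < lam"
        using k less.prems by auto
      obtain n g gh where "globe_attachment n g (X k) (X j) (f k j) gh"
        using succ_attachment[OF less.prems(2) succ] .
      then have "md_closed_embedding (X k) (X j) (f k j)"
        by (rule globe_attachment.md_closed_embedding_f)
      with less.IH[OF k(2,1) \<open>k < lam\<close>] show ?thesis
        by (rule md_closed_embedding_comp[OF mdspace[OF \<open>i < lam\<close>] mdspace[OF \<open>k < lam\<close>]])
          (use k less.prems(2) f_comp in auto)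
    next
      case limit
      have "md_closed_colimit {..<j} X f (X j) (\<lambda>\<mu>. f \<mu> j)"
        using less.IH less.prems(2) mdspace limit_cocone[OF less.prems(2) limit]
        by unfold_locales auto
      then show ?thesis
        by (rule md_closed_colimit.md_closed_embedding_h) (simp add: \<open>i < j\<close>)
    qed
  qed
qed

lemma md_closed_colimit_cocone:
  assumes "\<kappa> \<le> lam" "md_colimit_cocone {..<\<kappa>} X f Y h"
  shows "md_closed_colimit {..<\<kappa>} X f Y h"
  using assms mdspace md_closed_embedding_tower by unfold_locales auto

lemma t1_space_tower: "j < lam \<Longrightarrow> t1_space (md_top (X j))"
proof (induction j rule: less_induct)
  case (less j)
  show ?case
  proof (cases j rule: wellorder_trichotomy)
    case least
    then obtain E where "X j = md_set E"
      using least_discrete less.prems by blast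
    then show ?thesis
      by (simp add: md_set_def Hausdorff_imp_t1_space)
  next
    case (succ k)
    obtain n g gh where "globe_attachment n g (X k) (X j) (f k j) gh"
      using succ_attachment[OF less.prems succ] .
    then show ?thesis
      using less.IH is_succ_less[OF succ] less.prems less_trans
      by (blast intro: globe_attachment.t1_space_pushout)
  next
    case limit
    then interpret md_closed_colimit "{..<j}" X f "X j" "\<lambda>\<mu>. f \<mu> j"
      using less.prems by (intro md_closed_colimit_cocone limit_cocone) auto
    show ?thesis
      using less by (intro t1_space_colimit) auto
  qed
qed

lemma exec_top_colimit_tower:
  assumes \<kappa>: "\<kappa> \<le> lam" and cocone: "md_colimit_cocone {..<\<kappa>} X f Y h"
  shows "top_colimit {..<\<kappa>} (\<lambda>\<nu>. exec_top (X \<nu>)) (\<lambda>\<mu> \<nu>. pmap (f \<mu> \<nu>)) (exec_top Y)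
    (\<lambda>\<nu>. pmap (h \<nu>))"
proof -
  interpret md_closed_colimit "{..<\<kappa>}" X f Y h
    using assms by (rule md_closed_colimit_cocone)
  interpret t1_tower \<kappa> "\<lambda>\<nu>. md_top (X \<nu>)" f "md_top Y" h
  proof (intro t1_tower.intro t1_tower_axioms.intro closed_top_colimit_axioms)
    show "t1_space (md_top (X i))" if "i < \<kappa>" for i
      using that \<kappa> by (intro t1_space_tower) simp
    fix \<mu> assume "\<mu> < \<kappa>" "is_limit \<mu>"
    then interpret sub: md_closed_colimit "{..<\<mu>}" X f "X \<mu>" "\<lambda>i. f i \<mu>"
      using \<kappa> by (intro md_closed_colimit_cocone limit_cocone) auto
    show "closed_top_colimit {..<\<mu>} (\<lambda>\<nu>. md_top (X \<nu>)) f (md_top (X \<mu>)) (\<lambda>i. f i \<mu>)"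
      by (rule sub.closed_top_colimit_axioms)
  qed
  show ?thesis
    by (rule exec_top_colimit) (rule compactin_subset_stage)
qed

end

theorem theorem5p6:
  fixes lam :: "'i::wellorder"
    and X :: "'i \<Rightarrow> 'a mdspace"
    and f :: "'i \<Rightarrow> 'i \<Rightarrow> 'a \<Rightarrow> 'a"
    and Xlam :: "'a mdspace"
    and h :: "'i \<Rightarrow> 'a \<Rightarrow> 'a"
  assumes mds: "\<forall>\<nu><lam. is_mdspace (X \<nu>)"
    and maps: "\<forall>\<mu> \<nu>. \<mu> \<le> \<nu> \<and> \<nu> < lam \<longrightarrow> md_map (X \<mu>) (X \<nu>) (f \<mu> \<nu>)"
    and fid: "\<forall>\<nu><lam. \<forall>x\<in>topspace (md_top (X \<nu>)). f \<nu> \<nu> x = x"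
    and fcomp: "\<forall>\<mu> \<nu> \<rho>. \<mu> \<le> \<nu> \<and> \<nu> \<le> \<rho> \<and> \<rho> < lam \<longrightarrow>
                  (\<forall>x\<in>topspace (md_top (X \<mu>)). f \<mu> \<rho> x = f \<nu> \<rho> (f \<mu> \<nu> x))"
    and zero: "\<forall>\<nu><lam. is_least \<nu> \<longrightarrow> (\<exists>E. X \<nu> = md_set E)"
    and succ: "\<forall>\<nu> \<nu>'. \<nu>' < lam \<and> is_succ \<nu> \<nu>' \<longrightarrow>
                 (\<exists>n g gh. glob_pushout n g (X \<nu>) (X \<nu>') (f \<nu> \<nu>') gh)"
    and limit: "\<forall>\<nu><lam. is_limit \<nu> \<longrightarrow>
                  md_colimit {\<mu>. \<mu> < \<nu>} X f (X \<nu>) (\<lambda>\<mu>. f \<mu> \<nu>)"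
    and mdlam: "is_mdspace Xlam"
    and hmaps: "\<forall>\<nu><lam. md_map (X \<nu>) Xlam (h \<nu>)"
    and hcomp: "\<forall>\<nu> \<rho>. \<nu> \<le> \<rho> \<and> \<rho> < lam \<longrightarrow>
                  (\<forall>x\<in>topspace (md_top (X \<nu>)). h \<nu> x = h \<rho> (f \<nu> \<rho> x))"
    and colim: "md_colimit {\<nu>. \<nu> < lam} X f Xlam h"
  shows "(\<forall>\<nu><lam. is_limit \<nu> \<longrightarrow>
            top_colimit {\<mu>. \<mu> < \<nu>} (\<lambda>\<mu>. exec_top (X \<mu>)) (\<lambda>\<mu> \<rho>. pmap (f \<mu> \<rho>))
              (exec_top (X \<nu>)) (\<lambda>\<mu>. pmap (f \<mu> \<nu>)))
       \<and> top_colimit {\<nu>. \<nu> < lam} (\<lambda>\<nu>. exec_top (X \<nu>)) (\<lambda>\<mu> \<rho>. pmap (f \<mu> \<rho>))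
              (exec_top Xlam) (\<lambda>\<nu>. pmap (h \<nu>))"
  unfolding lessThan_def[symmetric]
proof (intro conjI allI impI)
  interpret globular_tower lam X f
  proof
    show "f \<nu> \<rho> (f \<mu> \<nu> x) = f \<mu> \<rho> x"
      if "\<mu> \<le> \<nu>" "\<nu> \<le> \<rho>" "\<rho> < lam" "x \<in> topspace (md_top (X \<mu>))" for \<mu> \<nu> \<rho> x
      using fcomp that by metis
  qed (use mds maps fid zero succ limit in \<open>simp_all add: lessThan_def\<close>)
  show "top_colimit {..<\<nu>} (\<lambda>\<mu>. exec_top (X \<mu>)) (\<lambda>\<mu> \<rho>. pmap (f \<mu> \<rho>))
      (exec_top (X \<nu>)) (\<lambda>\<mu>. pmap (f \<mu> \<nu>))" if "\<nu> < lam" "is_limit \<nu>" for \<nu>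
    using that by (intro exec_top_colimit_tower limit_cocone) auto
  have "md_colimit_cocone {..<lam} X f Xlam h"
    using mdlam hmaps hcomp colim by (auto simp: md_colimit_cocone_def lessThan_def)
  then show "top_colimit {..<lam} (\<lambda>\<nu>. exec_top (X \<nu>)) (\<lambda>\<mu> \<rho>. pmap (f \<mu> \<rho>))
      (exec_top Xlam) (\<lambda>\<nu>. pmap (h \<nu>))"
    by (rule exec_top_colimit_tower[OF order_refl])
qed

end
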